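(* Let $n\ge2$, and let $\Gamma\subset\mathbb{R}^n$ be a non-degenerate curve (of uniform finite type $(1,\ldots,n)$). Then, uniformly for $\delta\in\Delta_n$, $$N(\Gamma;\delta)\asymp\Bigl(\min_{1\le i\le n}\delta_i^{1/i}\Bigr)^{-1};$$ that is, there are constants $0<c\le C<\infty$, independent of $\delta$ and depending only on $n$ and the uniform chart and non-degeneracy data of $\Gamma$, such that $c\bigl(\min_i\delta_i^{1/i}\bigr)^{-1}\le N(\Gamma;\delta)\le C\bigl(\min_i\delta_i^{1/i}\bigr)^{-1}$ for every $\delta\in\Delta_n$.
   Context: Non-degenerate curve: let $\Gamma\subset\mathbb{R}^n$ be a non-empty compact embedded $C^{n+1}$ curve, possibly with boundary and not necessarily connected. At boundary points, local parametrisations are understood to have $C^{n+1}$ extensions to open intervals. $\Gamma$ is called non-degenerate, or of uniform finite type $(1,\ldots,n)$, if every local unit-speed parametrisation $\gamma$ satisfies $\det(\gamma'(s),\ldots,\gamma^{(n)}(s))\ne0$ at every parameter $s$ corresponding to a point of $\Gamma$. The uniform chart and non-degeneracy data of $\Gamma$ refer to a finite atlas of unit-speed (arclength) charts, a common chart radius, uniform bounds for derivatives of the charts up to order $n+1$, and a uniform positive lower bound for $\operatorname{dist}(\gamma^{(i)},\operatorname{span}\{\gamma',\dots,\gamma^{(i-1)}\})$, $1\le i\le n$. An open box in $\mathbb{R}^n$ is an open rectangular box with positive side lengths and arbitrary orientation; its side lengths in decreasing order are $l_1(B)\ge\cdots\ge l_n(B)>0$. Let $\Delta_n=\{\delta\in(0,1)^n:\delta_1\ge\cdots\ge\delta_n\}$.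 For non-empty bounded $F\subset\mathbb{R}^n$ and $\delta\in\Delta_n$, $N(F;\delta)$ is the least number of open boxes $B$ needed to cover $F$, subject to $l_i(B)\le\delta_i$ for $1\le i\le n$ for every box in the cover (boxes may have different orientations). *)

theory Defs
  imports "HOL-Analysis.Analysis"
begin

section \<open>Non-degenerate curves\<close>

definition vderiv :: "nat \<Rightarrow> (real \<Rightarrow> 'a::real_normed_vector) \<Rightarrow> real \<Rightarrow> 'a" where
  "vderiv k = (\<lambda>f t. vector_derivative f (at t)) ^^ k"

definition C_k_on :: "nat \<Rightarrow> (real \<Rightarrow> 'a::real_normed_vector) \<Rightarrow> real set \<Rightarrow> bool" where
  "C_k_on k f I \<longleftrightarrow>
     (\<forall>j<k. \<forall>t\<in>I. vderiv j f differentiable (at t)) \<and> continuous_on I (vderiv k f)"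

text \<open>
  Local unit-speed parametrisations of a one-dimensional manifold with boundary embedded in
  Euclidean space. The parameter domain \<open>J\<close> is a non-degenerate interval mapped
  homeomorphically onto a relatively open part of \<open>\<Gamma>\<close>; an endpoint of \<open>J\<close> that belongs
  to \<open>J\<close> therefore corresponds to a boundary point of \<open>\<Gamma>\<close>. The map \<open>\<gamma>\<close> carries the
  smooth extension to an open interval \<open>I\<close>. As \<open>J\<close> is non-degenerate, the derivatives of
  \<open>\<gamma>\<close> of order at most \<open>n + 1\<close> at points of \<open>J\<close> do not depend on the chosen extension.
\<close>
definition unit_speed_chart ::
  "(real ^ 'n) set \<Rightarrow> real set \<Rightarrow> (real \<Rightarrow> real ^ 'n) \<Rightarrow> bool" where
  "unit_speed_chart \<Gamma> J \<gamma> \<longleftrightarrow>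
     is_interval J \<and> interior J \<noteq> {} \<and>
     (\<exists>I. open I \<and> is_interval I \<and> J \<subseteq> I \<and> C_k_on (CARD('n) + 1) \<gamma> I) \<and>
     (\<forall>s\<in>J. norm (vderiv 1 \<gamma> s) = 1) \<and>
     openin (top_of_set \<Gamma>) (\<gamma> ` J) \<and>
     (\<exists>g. homeomorphism J (\<gamma> ` J) \<gamma> g)"

definition compact_embedded_curve :: "(real ^ 'n) set \<Rightarrow> bool" where
  "compact_embedded_curve \<Gamma> \<longleftrightarrow>
     \<Gamma> \<noteq> {} \<and> compact \<Gamma> \<and> (\<forall>p\<in>\<Gamma>. \<exists>J \<gamma>. unit_speed_chart \<Gamma> J \<gamma> \<and> p \<in> \<gamma> ` J)"

text \<open>
  The columns of this matrix are the derivatives of orders \<open>1, \<dots>, n\<close>. They are assigned to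
  the index type by the bijection \<open>to_nat_on UNIV\<close> onto \<open>{..<n}\<close>; another assignment
  changes at most the sign of the determinant.
\<close>
definition deriv_matrix :: "(real \<Rightarrow> real ^ 'n) \<Rightarrow> real \<Rightarrow> real ^ 'n ^ 'n" where
  "deriv_matrix \<gamma> s = (\<chi> i j. vderiv (Suc (to_nat_on (UNIV :: 'n set) j)) \<gamma> s $ i)"

definition nondegenerate_curve :: "(real ^ 'n) set \<Rightarrow> bool" where
  "nondegenerate_curve \<Gamma> \<longleftrightarrow>
     compact_embedded_curve \<Gamma> \<and>
     (\<forall>J \<gamma>. unit_speed_chart \<Gamma> J \<gamma> \<longrightarrow> (\<forall>s\<in>J. det (deriv_matrix \<gamma> s) \<noteq> 0))"

text \<open>
  Uniform chart and non-degeneracy data: \<open>K\<close> unit-speed charts of common radius \<open>r\<close>, centred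
  at parameter \<open>0\<close>, cover \<open>\<Gamma>\<close>. A half-open domain belongs to a chart centred at a boundary
  point. \<open>M\<close> bounds the derivatives up to order \<open>n + 1\<close> and \<open>\<kappa>\<close> bounds the distances from
  below, only at the parameters in the chart domains, not on their extensions.
\<close>
definition uniform_data ::
  "(real ^ 'n) set \<Rightarrow> nat \<Rightarrow> real \<Rightarrow> real \<Rightarrow> real \<Rightarrow> bool" where
  "uniform_data \<Gamma> K r M \<kappa> \<longleftrightarrow>
     0 < r \<and> 0 < \<kappa> \<and>
     (\<exists>(J :: nat \<Rightarrow> real set) \<gamma>.
        \<Gamma> = (\<Union>k<K. \<gamma> k ` J k) \<and>
        (\<forall>k<K.
           unit_speed_chart \<Gamma> (J k) (\<gamma> k) \<and>
           J k \<in> {{-r<..<r}, {0..<r}, {-r<..0}} \<and>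
           (\<forall>s\<in>J k.
              (\<forall>i\<in>{1..CARD('n) + 1}. norm (vderiv i (\<gamma> k) s) \<le> M) \<and>
              (\<forall>i\<in>{1..CARD('n)}.
                 \<kappa> \<le> infdist (vderiv i (\<gamma> k) s)
                        (span ((\<lambda>j. vderiv j (\<gamma> k) s) ` {1..<i}))))))"

section \<open>Anisotropic box-counting numbers\<close>

text \<open>
  Vectors of side lengths are functions on the natural numbers of which only the values at
  \<open>1, \<dots>, n\<close> matter.
\<close>
definition open_box_with_sides :: "(nat \<Rightarrow> real) \<Rightarrow> (real ^ 'n) set \<Rightarrow> bool" where
  "open_box_with_sides l B \<longleftrightarrow>
     (\<forall>i\<in>{1..CARD('n)}. 0 < l i) \<and>
     (\<forall>i\<in>{1..CARD('n)}. \<forall>j\<in>{1..CARD('n)}. i \<le> j \<longrightarrow> l j \<le> l i) \<and>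
     (\<exists>c (u :: nat \<Rightarrow> real ^ 'n).
        (\<forall>i\<in>{1..CARD('n)}. \<forall>j\<in>{1..CARD('n)}. u i \<bullet> u j = (if i = j then 1 else 0)) \<and>
        B = {x. \<forall>i\<in>{1..CARD('n)}. \<bar>(x - c) \<bullet> u i\<bar> < l i / 2})"

definition Delta :: "nat \<Rightarrow> (nat \<Rightarrow> real) set" where
  "Delta n = {\<delta>. (\<forall>i\<in>{1..n}. 0 < \<delta> i \<and> \<delta> i < 1) \<and>
                 (\<forall>i\<in>{1..n}. \<forall>j\<in>{1..n}. i \<le> j \<longrightarrow> \<delta> j \<le> \<delta> i)}"

definition box_cover :: "(nat \<Rightarrow> real) \<Rightarrow> (real ^ 'n) set \<Rightarrow> (real ^ 'n) set set \<Rightarrow> bool" where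
  "box_cover \<delta> F \<B> \<longleftrightarrow>
     F \<subseteq> \<Union>\<B> \<and>
     (\<forall>B\<in>\<B>. \<exists>l. open_box_with_sides l B \<and> (\<forall>i\<in>{1..CARD('n)}. l i \<le> \<delta> i))"

definition box_number :: "(real ^ 'n) set \<Rightarrow> (nat \<Rightarrow> real) \<Rightarrow> nat" where
  "box_number F \<delta> = (LEAST m. \<exists>\<B>. finite \<B> \<and> card \<B> = m \<and> box_cover \<delta> F \<B>)"

end

theory Submission
  imports Defs
begin

text \<open>
  Write \<open>n\<close> for the dimension and \<open>\<eta> = min \<delta> i powr (1/i)\<close>, so that \<open>\<eta> ^ i \<le> \<delta> i\<close> for every \<open>i\<close>, with
  equality for at least one \<open>i\<close>. The theorem says that a box with sides \<open>\<delta>\<close> can be placed so as to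
  capture an arc of length comparable to \<open>\<eta>\<close>, and that no box captures more than this order of length.

  Upper bound. At a point \<open>\<gamma> s0\<close> take an orthonormal frame whose \<open>i\<close>-th vector is orthogonal to the
  derivatives of orders below \<open>i\<close> (\<open>orthonormal_adapted_frame\<close>). By Taylor's formula the \<open>i\<close>-th
  component of \<open>\<gamma> s - \<gamma> s0\<close> is at most \<open>M * \<bar>s - s0\<bar> ^ i\<close>, so an arc of length a small multiple of
  \<open>\<eta>\<close> lies in a box with sides \<open>\<delta> i \<ge> \<eta> ^ i\<close> (\<open>chart_arc_in_box\<close>). The charts have total length at
  most \<open>2 * r * K\<close>, so a multiple of \<open>1 / \<eta>\<close> such boxes suffice.

  Lower bound. Choose \<open>i\<close> with \<open>\<delta> i = \<eta> ^ i\<close>. A box of the cover has width at most \<open>\<delta> i\<close> in \<open>n - i + 1\<close>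
  orthogonal directions. The span of the first \<open>i\<close> derivatives has dimension \<open>i\<close>, hence it contains
  a unit vector \<open>w\<close> in the span of these directions. As \<open>w\<close> is a combination of the first \<open>i\<close>
  derivatives with controlled coefficients, some derivative of order \<open>j \<le> i\<close> has an inner product
  with \<open>w\<close> that is bounded below (\<open>inner_le_on_span\<close>), and it remains so on an arc of fixed length.
  A function with a large \<open>j\<close>-th derivative is smaller than a multiple of \<open>t ^ j\<close> only on a set of
  measure \<open>O(t)\<close> (\<open>sublevel_set_small\<close>). With \<open>t\<close> a multiple of \<open>\<eta>\<close>, every box of the cover
  meets the fixed arc in measure \<open>O(\<eta>)\<close> (\<open>box_preimage_small\<close>), and at least a multiple of \<open>1 / \<eta>\<close>
  boxes are needed to cover this one arc.

  Existence of the uniform data is a double compactness argument: finitely many charts of various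
  radii give a common radius and common bounds, and then every point has a chart of exactly
  that radius, of which finitely many suffice again (\<open>uniform_data_exists\<close>).
\<close>

section \<open>Sublevel sets of functions with a large derivative\<close>

text \<open>
  The induction lowers the order of the derivative. As \<open>d k\<close> increases with slope at least \<open>lam\<close>, it
  is smaller than \<open>lam * t\<close> in absolute value only on a set of diameter at most \<open>2 * t\<close>; what remains
  of \<open>S\<close> is a left and a right part, on which \<open>- d k\<close> and \<open>d k\<close>, respectively, are at least \<open>lam * t\<close>.
  The constants obey \<open>c (k + 1) = 2 * c k + 2\<close> with \<open>c 0 = 0\<close>, hence the value \<open>2 ^ Suc k - 2\<close>. The
  measure of a superset is bounded, so that the three parts can simply be combined to a union.
\<close>
lemma sublevel_set_small:
  fixes d :: "nat \<Rightarrow> real \<Rightarrow> real"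
  assumes "is_interval S" and "0 < lam" and "0 < t"
    and "\<And>m s. m < k \<Longrightarrow> s \<in> S \<Longrightarrow> (d m has_real_derivative d (Suc m) s) (at s)"
    and "\<And>s. s \<in> S \<Longrightarrow> lam \<le> d k s"
  shows "\<exists>A\<in>lmeasurable. {s\<in>S. \<bar>d 0 s\<bar> < lam * t ^ k} \<subseteq> A \<and>
           measure lebesgue A \<le> (2 ^ Suc k - 2) * t"
  using assms
proof (induction k arbitrary: S d lam)
  case 0
  have "{s\<in>S. \<bar>d 0 s\<bar> < lam * t ^ 0} \<subseteq> {}"
    using "0.prems"(5) by fastforce
  then show ?case by (intro bexI[of _ "{}"]) auto
next
  case (Suc k)
  note S = \<open>is_interval S\<close> and lam = \<open>0 < lam\<close> and t = \<open>0 < t\<close>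
  have growth: "lam * (y - x) \<le> d k y - d k x" if "x \<in> S" "y \<in> S" "x \<le> y" for x y
  proof (cases "x = y")
    case False
    have sub: "s \<in> S" if "x \<le> s" "s \<le> y" for s
      using S that \<open>x \<in> S\<close> \<open>y \<in> S\<close> by (meson mem_is_interval_1_I)
    have "\<exists>z. x < z \<and> z < y \<and> d k y - d k x = (y - x) * d (Suc k) z"
      using False that(3) Suc.prems(4)[of k] sub by (intro MVT2) auto
    then obtain z where z: "x < z" "z < y" "d k y - d k x = (y - x) * d (Suc k) z" by blast
    then have "lam \<le> d (Suc k) z" using Suc.prems(5) sub by auto
    then show ?thesis using z that(3) by (simp add: mult.commute mult_left_mono)
  qed simp
  have mono: "d k x \<le> d k y" if "x \<in> S" "y \<in> S" "x \<le> y" for x y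
  proof -
    have "0 \<le> lam * (y - x)" using lam that by simp
    then show ?thesis using growth[OF that] by linarith
  qed
  \<comment> \<open>The right part, the left part and the short middle part of \<open>S\<close>.\<close>
  define P where "P = {s\<in>S. lam * t \<le> d k s}"
  define N where "N = {s\<in>S. lam * t \<le> - d k s}"
  define Z where "Z = {s\<in>S. \<bar>d k s\<bar> < lam * t}"
  have lt: "0 < lam * t" using lam t by simp
  have iP: "is_interval P"
    unfolding is_interval_1
  proof (intro ballI allI impI)
    fix a b x assume *: "a \<in> P" "b \<in> P" "a \<le> x \<and> x \<le> b"
    then have "x \<in> S" using S mem_is_interval_1_I unfolding P_def by blast
    moreover have "d k a \<le> d k x" using * \<open>x \<in> S\<close> mono unfolding P_def by auto
    ultimately show "x \<in> P" using * unfolding P_def by auto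
  qed
  have iN: "is_interval N"
    unfolding is_interval_1
  proof (intro ballI allI impI)
    fix a b x assume *: "a \<in> N" "b \<in> N" "a \<le> x \<and> x \<le> b"
    then have "x \<in> S" using S mem_is_interval_1_I unfolding N_def by blast
    moreover have "d k x \<le> d k b" using * \<open>x \<in> S\<close> mono unfolding N_def by auto
    ultimately show "x \<in> N" using * unfolding N_def by auto
  qed
  obtain A where A: "A \<in> lmeasurable" "{s\<in>P. \<bar>d 0 s\<bar> < lam * t * t ^ k} \<subseteq> A"
      "measure lebesgue A \<le> (2 ^ Suc k - 2) * t"
    using Suc.IH[OF iP lt t, of d] Suc.prems(4) unfolding P_def by fastforce
  have "\<exists>A\<in>lmeasurable. {s\<in>N. \<bar>- d 0 s\<bar> < lam * t * t ^ k} \<subseteq> A \<and>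
           measure lebesgue A \<le> (2 ^ Suc k - 2) * t"
  proof (rule Suc.IH[OF iN lt t, of "\<lambda>m s. - d m s"])
    show "((\<lambda>s. - d m s) has_real_derivative - d (Suc m) s) (at s)" if "m < k" "s \<in> N" for m s
      using that Suc.prems(4)[of m s] unfolding N_def by (auto intro: DERIV_minus)
    show "lam * t \<le> - d k s" if "s \<in> N" for s
      using that unfolding N_def by simp
  qed
  then obtain B where B: "B \<in> lmeasurable" "{s\<in>N. \<bar>d 0 s\<bar> < lam * t * t ^ k} \<subseteq> B"
      "measure lebesgue B \<le> (2 ^ Suc k - 2) * t"
    by auto
  have diam: "y - x \<le> 2 * t" if "x \<in> Z" "y \<in> Z" for x y
  proof (cases "x \<le> y")
    case True
    have "lam * (y - x) \<le> d k y - d k x" using growth True that unfolding Z_def by auto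
    also have "\<dots> \<le> lam * (2 * t)" using that unfolding Z_def by auto
    finally show ?thesis using lam by simp
  qed (use t in auto)
  have "\<exists>a. Z \<subseteq> {a..a + 2 * t}"
  proof (cases "Z = {}")
    case False
    then obtain z where z: "z \<in> Z" by blast
    have bdd: "bdd_below Z"
      by (rule bdd_belowI[of _ "z - 2 * t"]) (use diam z in fastforce)
    have "x \<le> Inf Z + 2 * t" if "x \<in> Z" for x
    proof -
      have "x - 2 * t \<le> Inf Z"
        by (rule cInf_greatest[OF False]) (use diam that in fastforce)
      then show ?thesis by simp
    qed
    then show ?thesis using cInf_lower[OF _ bdd] by (intro exI[of _ "Inf Z"]) auto
  qed simp
  then obtain a where a: "Z \<subseteq> {a..a + 2 * t}" by blast
  have sub: "{s\<in>S. \<bar>d 0 s\<bar> < lam * t ^ Suc k} \<subseteq> (A \<union> B) \<union> {a..a + 2 * t}"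
  proof
    fix s assume s: "s \<in> {s\<in>S. \<bar>d 0 s\<bar> < lam * t ^ Suc k}"
    then have "\<bar>d 0 s\<bar> < lam * t * t ^ k" by (simp add: mult.assoc)
    moreover have "s \<in> P \<or> s \<in> N \<or> s \<in> Z"
      using s unfolding P_def N_def Z_def by auto
    ultimately show "s \<in> (A \<union> B) \<union> {a..a + 2 * t}" using A(2) B(2) a by blast
  qed
  have "measure lebesgue ((A \<union> B) \<union> {a..a + 2 * t}) \<le>
      measure lebesgue A + measure lebesgue B + measure lebesgue {a..a + 2 * t}"
    using A(1) B(1) measure_Un_le[of "A \<union> B" lebesgue "{a..a + 2 * t}"]
      measure_Un_le[of A lebesgue B] by fastforce
  also have "measure lebesgue {a..a + 2 * t} = 2 * t" using t by simp
  also have "measure lebesgue A + measure lebesgue B + 2 * t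
      \<le> (2 ^ Suc k - 2) * t + (2 ^ Suc k - 2) * t + 2 * t"
    using A(3) B(3) by linarith
  also have "\<dots> = (2 ^ Suc (Suc k) - 2) * t" by (simp add: algebra_simps)
  finally show ?case using sub A(1) B(1)
    by (intro bexI[of _ "(A \<union> B) \<union> {a..a + 2 * t}"]) auto
qed

section \<open>Quantitatively independent vectors and adapted frames\<close>

text \<open>
  Quantitative form of the fact that a vector orthogonal to a basis is orthogonal to its span: if
  \<open>w\<close> is nearly orthogonal to all \<open>v j\<close>, it is nearly orthogonal to every \<open>x\<close> in their span. In
  \<open>x = a v (k+1) + y\<close> the distance condition bounds \<open>\<bar>a\<bar>\<close> by \<open>norm x / \<kappa>\<close>, hence \<open>norm y\<close> by
  \<open>(1 + M / \<kappa>) * norm x\<close>, and the factor \<open>1 + (M + 1) / \<kappa>\<close> per step absorbs both contributions. In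
  the application \<open>x = w\<close> is a unit vector, which forces some inner product to be large.
\<close>
lemma inner_le_on_span:
  fixes v :: "nat \<Rightarrow> 'a::euclidean_space"
  assumes "0 < \<kappa>" and "0 \<le> M" and "0 \<le> e"
    and "\<And>j. j \<in> {1..k} \<Longrightarrow> norm (v j) \<le> M"
    and "\<And>j. j \<in> {1..k} \<Longrightarrow> \<kappa> \<le> infdist (v j) (span (v ` {1..<j}))"
    and "\<And>j. j \<in> {1..k} \<Longrightarrow> \<bar>v j \<bullet> w\<bar> \<le> e"
    and "x \<in> span (v ` {1..k})"
  shows "\<bar>x \<bullet> w\<bar> \<le> (1 + (M + 1) / \<kappa>) ^ k * e * norm x"
  using assms(4-7)
proof (induction k arbitrary: x)
  case 0
  then show ?case using assms by simp
next
  case (Suc k)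
  have bounds: "norm (v (Suc k)) \<le> M" "\<kappa> \<le> infdist (v (Suc k)) (span (v ` {1..<Suc k}))"
    "\<bar>v (Suc k) \<bullet> w\<bar> \<le> e"
    using Suc.prems(1-3)[of "Suc k"] by auto
  have "{1..Suc k} = insert (Suc k) {1..k}" by auto
  then have "x \<in> span (insert (v (Suc k)) (v ` {1..k}))" using Suc.prems(4) by simp
  then obtain a where y: "x - a *\<^sub>R v (Suc k) \<in> span (v ` {1..k})" (is "?y \<in> _")
    by (auto simp: span_insert)
  \<comment> \<open>For \<open>a \<noteq> 0\<close>, \<open>x / a\<close> is the difference of \<open>v (k+1)\<close> and a vector of the span of the earlier ones.\<close>
  have a: "\<bar>a\<bar> * \<kappa> \<le> norm x"
  proof (cases "a = 0")
    case False
    have "- (1 / a) *\<^sub>R ?y \<in> span (v ` {1..<Suc k})"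
      using y by (intro span_scale) (simp add: atLeastLessThanSuc_atLeastAtMost)
    then have "\<kappa> \<le> dist (v (Suc k)) (- (1 / a) *\<^sub>R ?y)"
      by (rule order_trans[OF bounds(2) infdist_le])
    also have "\<dots> = norm ((1 / a) *\<^sub>R x)"
      using False by (simp add: dist_norm algebra_simps)
    finally show ?thesis using False by (simp add: field_simps)
  qed simp
  then have a': "\<bar>a\<bar> \<le> norm x / \<kappa>" using assms(1) by (simp add: field_simps)
  have "norm ?y \<le> norm x + \<bar>a\<bar> * norm (v (Suc k))"
    using norm_triangle_ineq4[of x "a *\<^sub>R v (Suc k)"] by simp
  also have "\<dots> \<le> norm x + norm x / \<kappa> * M"
    using a' bounds(1) assms(1) by (intro add_left_mono mult_mono) auto
  also have "\<dots> = norm x * (1 + M / \<kappa>)" by (simp add: algebra_simps)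
  finally have ny: "norm ?y \<le> norm x * (1 + M / \<kappa>)" .
  define D where "D = (1 + (M + 1) / \<kappa>) ^ k"
  have D: "1 \<le> D" using assms(1,2) unfolding D_def by (simp add: one_le_power)
  have "\<bar>?y \<bullet> w\<bar> \<le> D * e * norm ?y"
    unfolding D_def by (rule Suc.IH) (use Suc.prems y in auto)
  also have "\<dots> \<le> D * e * (norm x * (1 + M / \<kappa>))"
    using ny D assms(3) by (intro mult_left_mono) auto
  finally have yw: "\<bar>?y \<bullet> w\<bar> \<le> D * e * (norm x * (1 + M / \<kappa>))" .
  have "\<bar>a * (v (Suc k) \<bullet> w)\<bar> \<le> norm x / \<kappa> * e"
    unfolding abs_mult using a' bounds(3) assms(1) by (intro mult_mono) auto
  also have "\<dots> \<le> D * (norm x / \<kappa> * e)"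
    using D assms(1,3) mult_right_mono[of 1 D "norm x / \<kappa> * e"] by auto
  finally have aw: "\<bar>a * (v (Suc k) \<bullet> w)\<bar> \<le> D * (norm x / \<kappa> * e)" .
  have "x \<bullet> w = a * (v (Suc k) \<bullet> w) + ?y \<bullet> w" by (simp add: inner_diff_left)
  then have "\<bar>x \<bullet> w\<bar> \<le> D * (norm x / \<kappa> * e) + D * e * (norm x * (1 + M / \<kappa>))"
    using yw aw by linarith
  also have "\<dots> = (1 + (M + 1) / \<kappa>) ^ Suc k * e * norm x"
    unfolding power_Suc D_def[symmetric] using assms(1) by (simp add: field_simps)
  finally show ?case .
qed

lemma dim_span_of_infdist_pos:
  fixes v :: "nat \<Rightarrow> 'a::euclidean_space"
  assumes "0 < \<kappa>"
    and "\<And>j. j \<in> {1..k} \<Longrightarrow> \<kappa> \<le> infdist (v j) (span (v ` {1..<j}))"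
  shows "dim (v ` {1..k}) = k"
  using assms(2)
proof (induction k)
  case (Suc k)
  have "\<kappa> \<le> infdist (v (Suc k)) (span (v ` {1..k}))"
    using Suc.prems[of "Suc k"] by (simp add: atLeastLessThanSuc_atLeastAtMost)
  then have "v (Suc k) \<notin> span (v ` {1..k})" using assms(1) infdist_zero by fastforce
  moreover have "{1..Suc k} = insert (Suc k) {1..k}" by auto
  ultimately show ?case using Suc by (simp add: dim_insert)
qed simp

text \<open>
  The \<open>k - 1\<close> orthogonality conditions cut out a subspace of codimension at most \<open>k - 1\<close>, which must
  meet a space of dimension \<open>k\<close>.
\<close>
lemma unit_vector_in_span_orthogonal:
  fixes v u :: "nat \<Rightarrow> 'a::euclidean_space"
  assumes "dim (v ` {1..k}) = k" and "1 \<le> k"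
  obtains w where "w \<in> span (v ` {1..k})" and "norm w = 1"
    and "\<And>j. j \<in> {1..<k} \<Longrightarrow> w \<bullet> u j = 0"
proof -
  let ?V = "span (v ` {1..k})" and ?U = "span (u ` {1..<k})"
  let ?T = "{y \<in> UNIV. \<forall>x\<in>?U. orthogonal x y}"
  have "dim (u ` {1..<k}) \<le> card (u ` {1..<k})" by (intro dim_le_card') simp
  also have "\<dots> \<le> card {1..<k}" by (intro card_image_le) simp
  finally have dU: "dim ?U \<le> k - 1" by simp
  have dT: "dim ?T + dim ?U = DIM('a)"
    using dim_subspace_orthogonal_to_vectors[of ?U UNIV] by simp
  have "subspace ?T"
    using subspace_orthogonal_to_vectors[of ?U] by simp
  then have "dim {x + y |x y. x \<in> ?V \<and> y \<in> ?T} + dim (?V \<inter> ?T) = dim ?V + dim ?T"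
    by (intro dim_sums_Int) auto
  moreover have "dim {x + y |x y. x \<in> ?V \<and> y \<in> ?T} \<le> DIM('a)"
    by (rule dim_subset_UNIV)
  moreover have "dim ?V = k" using assms(1) by simp
  ultimately have "dim (?V \<inter> ?T) \<noteq> 0" using dU dT assms(2) by linarith
  then obtain z where z: "z \<in> ?V" "z \<in> ?T" "z \<noteq> 0" by (auto simp: dim_eq_0)
  show thesis
  proof (rule that[of "(1 / norm z) *\<^sub>R z"])
    show "(1 / norm z) *\<^sub>R z \<in> ?V" using z(1) by (rule span_scale)
    show "norm ((1 / norm z) *\<^sub>R z) = 1" using z(3) by simp
    show "((1 / norm z) *\<^sub>R z) \<bullet> u j = 0" if "j \<in> {1..<k}" for j
    proof -
      have "u j \<in> ?U" using that by (intro span_base) auto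
      then have "orthogonal (u j) z" using z(2) by blast
      then show ?thesis by (simp add: orthogonal_def inner_commute)
    qed
  qed
qed

text \<open>
  The frame is built from the last vector downwards: \<open>u i\<close> has to be orthogonal to
  \<open>v 1, \<dots>, v (i - 1)\<close> and to the vectors \<open>u (i + 1), \<dots>, u n\<close> already chosen, and these \<open>n - 1\<close>
  linear conditions always leave a unit vector.
\<close>
lemma orthonormal_adapted_frame:
  fixes v :: "nat \<Rightarrow> 'a::euclidean_space"
  obtains u :: "nat \<Rightarrow> 'a"
  where "\<And>i j. i \<in> {1..DIM('a)} \<Longrightarrow> j \<in> {1..DIM('a)} \<Longrightarrow> u i \<bullet> u j = (if i = j then 1 else 0)"
    and "\<And>i j. i \<in> {1..DIM('a)} \<Longrightarrow> j \<in> {1..<i} \<Longrightarrow> v j \<bullet> u i = 0"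
proof -
  let ?n = "DIM('a)"
  let ?good = "\<lambda>k (u :: nat \<Rightarrow> 'a).
     (\<forall>i\<in>{k<..?n}. \<forall>j\<in>{k<..?n}. u i \<bullet> u j = (if i = j then 1 else 0)) \<and>
     (\<forall>i\<in>{k<..?n}. \<forall>j\<in>{1..<i}. v j \<bullet> u i = 0)"
  have "\<exists>u. ?good (?n - k) u" if "k \<le> ?n" for k
    using that
  proof (induction k)
    case (Suc k)
    let ?i = "?n - k"
    obtain u where u: "?good ?i u" using Suc by auto
    define S where "S = v ` {1..<?i} \<union> u ` {?i<..?n}"
    have "card S \<le> card (v ` {1..<?i}) + card (u ` {?i<..?n})"
      unfolding S_def by (rule card_Un_le)
    also have "\<dots> \<le> card {1..<?i} + card {?i<..?n}"
      by (intro add_mono card_image_le) auto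
    also have "\<dots> < ?n" using Suc.prems by auto
    finally have "dim S < ?n"
      using dim_le_card'[of S] unfolding S_def by auto
    then have "span S \<noteq> UNIV" by (metis dim_UNIV dim_span less_irrefl)
    then have "span S \<subset> span UNIV" by auto
    then obtain x where x: "x \<noteq> 0" "\<And>y. y \<in> span S \<Longrightarrow> orthogonal x y"
      using orthogonal_to_subspace_exists_gen by metis
    define e where "e = (1 / norm x) *\<^sub>R x"
    have e: "norm e = 1" using x(1) unfolding e_def by simp
    have ee: "e \<bullet> e = 1" using e by (simp add: dot_square_norm)
    have eS: "e \<bullet> y = 0" "y \<bullet> e = 0" if "y \<in> S" for y
      using x(2)[OF span_base[OF that]] unfolding e_def
      by (auto simp: orthogonal_def inner_commute)
    have dec: "{?n - Suc k<..?n} = insert ?i {?i<..?n}" using Suc.prems by auto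
    have "?good (?n - Suc k) (u(?i := e))"
      unfolding dec using u ee eS unfolding S_def by auto
    then show ?case by blast
  qed auto
  from this[of ?n] obtain u where "?good 0 u" by auto
  then show thesis by (intro that[of u]) auto
qed

lemma inner_orthonormal_expansion:
  fixes u :: "nat \<Rightarrow> 'a::euclidean_space"
  assumes "\<And>i j. i \<in> {1..DIM('a)} \<Longrightarrow> j \<in> {1..DIM('a)} \<Longrightarrow> u i \<bullet> u j = (if i = j then 1 else 0)"
  shows "z \<bullet> w = (\<Sum>j\<in>{1..DIM('a)}. (z \<bullet> u j) * (w \<bullet> u j))"
proof -
  let ?I = "{1..DIM('a)}"
  have inj: "inj_on u ?I"
    by (rule inj_onI) (metis assms zero_neq_one)
  have orth: "pairwise orthogonal (u ` ?I)"
    using assms by (auto simp: pairwise_def orthogonal_def)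
  have norm1: "norm b = 1" if "b \<in> u ` ?I" for b
    using that assms by (auto simp: norm_eq_1)
  have "independent (u ` ?I)"
    using norm1 by (intro pairwise_orthogonal_independent[OF orth]) force
  moreover have "card (u ` ?I) = DIM('a)" using card_image[OF inj] by simp
  ultimately have "UNIV \<subseteq> span (u ` ?I)"
    by (intro card_ge_dim_independent) auto
  then have "z = (\<Sum>b\<in>u ` ?I. (z \<bullet> b) *\<^sub>R b)"
    by (intro orthonormal_basis_expand[OF orth norm1, symmetric]) auto
  also have "\<dots> = (\<Sum>j\<in>?I. (z \<bullet> u j) *\<^sub>R u j)"
    by (simp only: sum.reindex[OF inj] o_def)
  finally have "z \<bullet> w = (\<Sum>j\<in>?I. (z \<bullet> u j) *\<^sub>R u j) \<bullet> w" by simp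
  then show ?thesis by (simp add: inner_sum_left inner_commute[of w])
qed

section \<open>Charts and their derivatives\<close>

definition centred_intervals :: "real \<Rightarrow> real set set" where
  "centred_intervals r = {{-r<..<r}, {0..<r}, {-r<..0}}"

definition chart_bounds :: "real \<Rightarrow> real \<Rightarrow> real set \<Rightarrow> (real \<Rightarrow> real ^ 'n) \<Rightarrow> bool" where
  "chart_bounds M \<kappa> J \<gamma> \<longleftrightarrow>
     (\<forall>s\<in>J.
        (\<forall>i\<in>{1..CARD('n) + 1}. norm (vderiv i \<gamma> s) \<le> M) \<and>
        (\<forall>i\<in>{1..CARD('n)}.
           \<kappa> \<le> infdist (vderiv i \<gamma> s) (span ((\<lambda>j. vderiv j \<gamma> s) ` {1..<i}))))"

lemma uniform_data_iff:
  fixes \<Gamma> :: "(real ^ 'n) set"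
  shows "uniform_data \<Gamma> K r M \<kappa> \<longleftrightarrow>
    0 < r \<and> 0 < \<kappa> \<and>
    (\<exists>J \<gamma>. \<Gamma> = (\<Union>k<K. \<gamma> k ` J k) \<and>
       (\<forall>k<K. unit_speed_chart \<Gamma> (J k) (\<gamma> k) \<and> J k \<in> centred_intervals r \<and>
              chart_bounds M \<kappa> (J k) (\<gamma> k)))"
  unfolding uniform_data_def centred_intervals_def chart_bounds_def by blast

lemma centred_interval_props:
  assumes "J \<in> centred_intervals r" and "0 < r"
  shows "is_interval J" and "interior J \<noteq> {}" and "0 \<in> J"
proof -
  show "is_interval J"
    using assms unfolding centred_intervals_def
    by (auto simp: is_interval_1)
  have "{0<..<r} \<subseteq> interior J \<or> {-r<..<0} \<subseteq> interior J"
    using assms unfolding centred_intervals_def by (auto intro!: interior_maximal)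
  moreover have "r / 2 \<in> {0<..<r}" "- r / 2 \<in> {-r<..<0}" using assms(2) by auto
  ultimately show "interior J \<noteq> {}" by blast
  show "0 \<in> J" using assms unfolding centred_intervals_def by auto
qed

lemma vderiv_0 [simp]: "vderiv 0 f = f"
  by (simp add: vderiv_def)

lemma vderiv_Suc: "vderiv (Suc k) f t = vector_derivative (vderiv k f) (at t)"
  by (simp add: vderiv_def)

lemma chart_has_vector_derivative:
  fixes \<gamma> :: "real \<Rightarrow> real ^ 'n"
  assumes "unit_speed_chart \<Gamma> J \<gamma>" and "s \<in> J" and "m \<le> CARD('n)"
  shows "(vderiv m \<gamma> has_vector_derivative vderiv (Suc m) \<gamma> s) (at s)"
  using assms vector_derivative_works
  unfolding unit_speed_chart_def C_k_on_def vderiv_Suc by fastforce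

text \<open>
  The components of a chart relative to the point \<open>a\<close>, in the form of a sequence of successive
  derivatives; \<open>a\<close> is subtracted from the function only and disappears from its derivatives.
\<close>
lemma chart_component_has_derivative:
  fixes \<gamma> :: "real \<Rightarrow> real ^ 'n"
  assumes "unit_speed_chart \<Gamma> J \<gamma>" and "s \<in> J" and "m \<le> CARD('n)"
    and d: "d = (\<lambda>m s. (vderiv m \<gamma> s - (if m = 0 then a else 0)) \<bullet> w)"
  shows "(d m has_real_derivative d (Suc m) s) (at s)"
proof -
  let ?a = "if m = 0 then a else 0"
  have "((\<lambda>s. vderiv m \<gamma> s - ?a) has_vector_derivative vderiv (Suc m) \<gamma> s) (at s)"
    using has_vector_derivative_diff[OF chart_has_vector_derivative[OF assms(1-3)]
        has_vector_derivative_const[of ?a]]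
    by simp
  then have "((\<lambda>s. (vderiv m \<gamma> s - ?a) \<bullet> w) has_vector_derivative vderiv (Suc m) \<gamma> s \<bullet> w) (at s)"
    by (rule bounded_linear.has_vector_derivative[OF bounded_linear_inner_left])
  moreover have "d (Suc m) s = vderiv (Suc m) \<gamma> s \<bullet> w" unfolding d by simp
  ultimately show ?thesis unfolding d has_real_derivative_iff_has_vector_derivative by simp
qed

lemma one_le_bound_of_unit_speed:
  fixes \<gamma> :: "real \<Rightarrow> real ^ 'n"
  assumes "unit_speed_chart \<Gamma> J \<gamma>" and "chart_bounds M \<kappa> J \<gamma>" and "J \<noteq> {}"
  shows "1 \<le> M"
proof -
  obtain s where "s \<in> J" using assms(3) by blast
  moreover have "1 \<in> {1..CARD('n) + 1}" by simp
  ultimately show ?thesis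
    using assms(1,2) unfolding unit_speed_chart_def chart_bounds_def by metis
qed

section \<open>Covering the curve by boxes\<close>

text \<open>
  In a frame adapted to the derivatives at \<open>s0\<close>, the \<open>i\<close>-th component of \<open>\<gamma> s - \<gamma> s0\<close> vanishes at
  \<open>s0\<close> to order \<open>i\<close>, so Taylor's formula leaves only the remainder of order \<open>i\<close>.
\<close>
lemma chart_arc_in_box:
  fixes \<gamma> :: "real \<Rightarrow> real ^ 'n"
  assumes chart: "unit_speed_chart \<Gamma> J \<gamma>" and bounds: "chart_bounds M \<kappa> J \<gamma>"
    and s0: "s0 \<in> J" and \<delta>: "\<delta> \<in> Delta CARD('n)"
    and h: "\<And>i. i \<in> {1..CARD('n)} \<Longrightarrow> 2 * M * h ^ i < \<delta> i"
  shows "\<exists>B. open_box_with_sides \<delta> B \<and> \<gamma> ` {s\<in>J. \<bar>s - s0\<bar> \<le> h} \<subseteq> B"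
proof -
  let ?n = "CARD('n)"
  obtain u :: "nat \<Rightarrow> real ^ 'n"
    where on: "\<And>i j. i \<in> {1..?n} \<Longrightarrow> j \<in> {1..?n} \<Longrightarrow> u i \<bullet> u j = (if i = j then 1 else 0)"
      and adapted: "\<And>i j. i \<in> {1..?n} \<Longrightarrow> j \<in> {1..<i} \<Longrightarrow> vderiv j \<gamma> s0 \<bullet> u i = 0"
    using orthonormal_adapted_frame[of "\<lambda>j. vderiv j \<gamma> s0"] by auto
  let ?B = "{x. \<forall>i\<in>{1..?n}. \<bar>(x - \<gamma> s0) \<bullet> u i\<bar> < \<delta> i / 2}"
  have box: "open_box_with_sides \<delta> ?B"
    unfolding open_box_with_sides_def
  proof (intro conjI exI[of _ "\<gamma> s0"] exI[of _ u])
    show "\<forall>i\<in>{1..?n}. \<forall>j\<in>{1..?n}. u i \<bullet> u j = (if i = j then 1 else 0)"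
      using on by blast
  qed (use \<delta> in \<open>auto simp: Delta_def\<close>)
  have J: "is_interval J" using chart unfolding unit_speed_chart_def by blast
  have "\<bar>(\<gamma> s - \<gamma> s0) \<bullet> u i\<bar> < \<delta> i / 2"
    if s: "s \<in> J" "\<bar>s - s0\<bar> \<le> h" and i: "i \<in> {1..?n}" for s i
  proof (cases "s = s0")
    case True
    then show ?thesis using \<delta> i by (auto simp: Delta_def)
  next
    case False
    define d where "d m s = (vderiv m \<gamma> s - (if m = 0 then \<gamma> s0 else 0)) \<bullet> u i" for m s
    have seg: "x \<in> J" if "min s s0 \<le> x" "x \<le> max s s0" for x
    proof -
      have "min s s0 \<in> J" "max s s0 \<in> J" using s s0 by (auto simp: min_def max_def)
      then show ?thesis using J that mem_is_interval_1_I by blast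
    qed
    have der: "(d m has_real_derivative d (Suc m) x) (at x)" if "x \<in> J" "m < i" for m x
      using that i by (intro chart_component_has_derivative[OF chart]) (auto simp: d_def fun_eq_iff)
    have "\<exists>x. (if s < s0 then s < x \<and> x < s0 else s0 < x \<and> x < s) \<and>
        d 0 s = (\<Sum>m<i. (d m s0 / fact m) * (s - s0) ^ m) + (d i x / fact i) * (s - s0) ^ i"
      using der seg False i by (intro Taylor[of i d "d 0" "min s s0" "max s s0"]) auto
    then obtain x where x: "if s < s0 then s < x \<and> x < s0 else s0 < x \<and> x < s"
      and taylor: "d 0 s = (\<Sum>m<i. (d m s0 / fact m) * (s - s0) ^ m) + (d i x / fact i) * (s - s0) ^ i"
      by blast
    have "d m s0 = 0" if "m < i" for m
      using adapted[OF i, of m] that unfolding d_def by (cases "m = 0") auto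
    then have "\<bar>d 0 s\<bar> = \<bar>d i x\<bar> * \<bar>s - s0\<bar> ^ i / fact i"
      using taylor by (simp add: abs_mult power_abs)
    also have "\<dots> \<le> \<bar>d i x\<bar> * \<bar>s - s0\<bar> ^ i"
      by (simp add: divide_le_eq_1_pos mult_left_le divide_inverse inverse_le_1_iff)
    also have "\<dots> \<le> M * h ^ i"
    proof (intro mult_mono power_mono)
      have "x \<in> J" using x by (intro seg) (auto split: if_splits)
      then have "norm (vderiv i \<gamma> x) \<le> M" using bounds i unfolding chart_bounds_def by auto
      moreover have "norm (u i) = 1" using on[OF i i] by (simp add: norm_eq_1)
      ultimately show "\<bar>d i x\<bar> \<le> M"
        using Cauchy_Schwarz_ineq2[of "vderiv i \<gamma> x" "u i"] i unfolding d_def by auto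
      then show "0 \<le> M" by simp
    qed (use s in auto)
    finally show ?thesis using h[OF i] unfolding d_def by simp
  qed
  then have "\<gamma> ` {s\<in>J. \<bar>s - s0\<bar> \<le> h} \<subseteq> ?B" by blast
  then show ?thesis using box by blast
qed

text \<open>
  Each parameter interval is cut into cells of length \<open>h\<close>, at most \<open>2 * r / h + 1\<close> of them, and the
  part of the curve over each cell is put into one box.
\<close>
lemma box_cover_exists:
  fixes \<Gamma> :: "(real ^ 'n) set"
  assumes ud: "uniform_data \<Gamma> K r M \<kappa>" and \<delta>: "\<delta> \<in> Delta CARD('n)" and "0 < h"
    and h: "\<And>i. i \<in> {1..CARD('n)} \<Longrightarrow> 2 * M * h ^ i < \<delta> i"
  shows "\<exists>\<B>. finite \<B> \<and> real (card \<B>) \<le> real K * (2 * r / h + 1) \<and> box_cover \<delta> \<Gamma> \<B>"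
proof -
  obtain J \<gamma> where r: "0 < r" and cov: "\<Gamma> = (\<Union>k<K. \<gamma> k ` J k)"
    and chart: "\<And>k. k < K \<Longrightarrow> unit_speed_chart \<Gamma> (J k) (\<gamma> k)"
    and cen: "\<And>k. k < K \<Longrightarrow> J k \<in> centred_intervals r"
    and bounds: "\<And>k. k < K \<Longrightarrow> chart_bounds M \<kappa> (J k) (\<gamma> k)"
    using ud unfolding uniform_data_iff by blast
  define N where "N = nat \<lfloor>2 * r / h\<rfloor>"
  define cell where "cell k m = {s\<in>J k. r + s \<in> {real m * h..real (Suc m) * h}}" for k m
  have "\<exists>B. open_box_with_sides \<delta> B \<and> \<gamma> k ` cell k m \<subseteq> B" if k: "k < K" for k m
  proof -
    \<comment> \<open>An empty cell still receives a box, around an arbitrary point of the chart.\<close>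
    have "J k \<noteq> {}" using cen[OF k] r unfolding centred_intervals_def by auto
    then obtain s0 where s0: "s0 \<in> J k" "cell k m \<noteq> {} \<longrightarrow> s0 \<in> cell k m"
      unfolding cell_def by blast
    obtain B where "open_box_with_sides \<delta> B" "\<gamma> k ` {s\<in>J k. \<bar>s - s0\<bar> \<le> h} \<subseteq> B"
      using chart_arc_in_box[OF chart[OF k] bounds[OF k] s0(1) \<delta> h] by blast
    moreover have "cell k m \<subseteq> {s\<in>J k. \<bar>s - s0\<bar> \<le> h}"
      using s0(2) unfolding cell_def by (fastforce simp: algebra_simps)
    ultimately show ?thesis by blast
  qed
  then obtain b where b: "\<And>k m. k < K \<Longrightarrow> open_box_with_sides \<delta> (b k m) \<and> \<gamma> k ` cell k m \<subseteq> b k m"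
    by metis
  define \<B> where "\<B> = (\<lambda>(k, m). b k m) ` ({..<K} \<times> {..N})"
  have "card \<B> \<le> card ({..<K} \<times> {..N})" unfolding \<B>_def by (intro card_image_le) auto
  also have "\<dots> = K * Suc N" by (simp add: card_cartesian_product)
  finally have "real (card \<B>) \<le> real K * real (Suc N)" by (metis of_nat_le_iff of_nat_mult)
  also have "\<dots> \<le> real K * (2 * r / h + 1)"
    using r \<open>0 < h\<close> unfolding N_def by (intro mult_left_mono) auto
  finally have card: "real (card \<B>) \<le> real K * (2 * r / h + 1)" .
  have "x \<in> \<Union>\<B>" if "x \<in> \<Gamma>" for x
  proof -
    have "x \<in> (\<Union>k<K. \<gamma> k ` J k)" using that unfolding cov .
    then obtain k s where k: "k < K" and s: "s \<in> J k" and x: "x = \<gamma> k s" by blast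
    have range: "- r \<le> s" "s \<le> r" using cen[OF k] s r unfolding centred_intervals_def by auto
    define m where "m = nat \<lfloor>(r + s) / h\<rfloor>"
    have "0 \<le> (r + s) / h" using range \<open>0 < h\<close> by simp
    then have "real m = of_int \<lfloor>(r + s) / h\<rfloor>" unfolding m_def by simp
    then have "real m \<le> (r + s) / h" "(r + s) / h \<le> real (Suc m)" by linarith+
    then have "s \<in> cell k m"
      using s \<open>0 < h\<close> unfolding cell_def by (simp add: field_simps)
    moreover have "m \<le> N"
      unfolding m_def N_def using range \<open>0 < h\<close>
      by (intro nat_mono floor_mono divide_right_mono) auto
    ultimately show ?thesis using k b[OF k, of m] x unfolding \<B>_def by fastforce
  qed
  moreover have "\<exists>l. open_box_with_sides l B \<and> (\<forall>i\<in>{1..CARD('n)}. l i \<le> \<delta> i)" if "B \<in> \<B>" for B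
    using that b unfolding \<B>_def by (intro exI[of _ \<delta>]) auto
  ultimately have "box_cover \<delta> \<Gamma> \<B>" unfolding box_cover_def by blast
  moreover have "finite \<B>" unfolding \<B>_def by simp
  ultimately show ?thesis using card by blast
qed

section \<open>The measure of the parameters that one box captures\<close>

text \<open>
  If \<open>w\<close> is orthogonal to the first \<open>i - 1\<close> axes of the box, only its axes of length at most \<open>l i\<close>
  contribute to the width of the box in direction \<open>w\<close>.
\<close>
lemma inner_small_in_box:
  fixes B :: "(real ^ 'n) set"
  assumes "open_box_with_sides l B" and "i \<in> {1..CARD('n)}" and "l i \<le> e"
  obtains c and u :: "nat \<Rightarrow> real ^ 'n"
  where "\<And>x w. x \<in> B \<Longrightarrow> norm w = 1 \<Longrightarrow> (\<And>j. j \<in> {1..<i} \<Longrightarrow> w \<bullet> u j = 0)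
           \<Longrightarrow> \<bar>(x - c) \<bullet> w\<bar> < real CARD('n) * e"
proof -
  let ?n = "CARD('n)"
  have l: "\<And>j. j \<in> {1..?n} \<Longrightarrow> 0 < l j" "\<And>j. j \<in> {1..?n} \<Longrightarrow> i \<le> j \<Longrightarrow> l j \<le> l i"
    using assms(1,2) unfolding open_box_with_sides_def by blast+
  obtain c and u :: "nat \<Rightarrow> real ^ 'n"
    where on: "\<And>i j. i \<in> {1..?n} \<Longrightarrow> j \<in> {1..?n} \<Longrightarrow> u i \<bullet> u j = (if i = j then 1 else 0)"
      and B: "B = {x. \<forall>i\<in>{1..?n}. \<bar>(x - c) \<bullet> u i\<bar> < l i / 2}"
    using assms(1) unfolding open_box_with_sides_def by blast
  show thesis
  proof (rule that)
    fix x w assume x: "x \<in> B" and w: "norm w = 1" "\<And>j. j \<in> {1..<i} \<Longrightarrow> w \<bullet> u j = 0"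
    have summand: "\<bar>((x - c) \<bullet> u j) * (w \<bullet> u j)\<bar> \<le> e / 2" if j: "j \<in> {1..?n}" for j
    proof (cases "j < i")
      case True
      then show ?thesis using w(2)[of j] j l(1)[OF assms(2)] assms(3) by auto
    next
      case False
      have "norm (u j) = 1" using on[OF j j] by (simp add: norm_eq_1)
      then have "\<bar>w \<bullet> u j\<bar> \<le> 1" using Cauchy_Schwarz_ineq2[of w "u j"] w(1) by simp
      moreover have "\<bar>(x - c) \<bullet> u j\<bar> \<le> e / 2" using x j l(2)[OF j] False assms(3) unfolding B by force
      ultimately have "\<bar>(x - c) \<bullet> u j\<bar> * \<bar>w \<bullet> u j\<bar> \<le> e / 2 * 1" by (intro mult_mono) auto
      then show ?thesis by (simp add: abs_mult)
    qed
    have "\<bar>(x - c) \<bullet> w\<bar> = \<bar>\<Sum>j\<in>{1..?n}. ((x - c) \<bullet> u j) * (w \<bullet> u j)\<bar>"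
      using inner_orthonormal_expansion[of u "x - c" w] on by simp
    also have "\<dots> \<le> (\<Sum>j\<in>{1..?n}. \<bar>((x - c) \<bullet> u j) * (w \<bullet> u j)\<bar>)" by (rule sum_abs)
    also have "\<dots> \<le> (\<Sum>j\<in>{1..?n}. e / 2)" by (intro sum_mono summand)
    also have "\<dots> = real ?n * (e / 2)" by simp
    also have "\<dots> < real ?n * e"
      using l(1)[OF assms(2)] assms(3) by (intro mult_strict_left_mono) auto
    finally show "\<bar>(x - c) \<bullet> w\<bar> < real ?n * e" .
  qed
qed

text \<open>
  The direction \<open>w\<close> lies both in the span of the first \<open>i\<close> derivatives at \<open>p\<close> and in the span of the
  short axes of the box. It depends on the box, but the lower bound \<open>1 / (2 * L)\<close> for one of the
  derivatives of \<open>\<gamma> \<bullet> w\<close> at \<open>p\<close> does not, and therefore neither does the length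
  \<open>1 / (4 * L * M)\<close> on which half of this bound persists.
\<close>
lemma box_preimage_small:
  fixes \<gamma> :: "real \<Rightarrow> real ^ 'n"
  assumes chart: "unit_speed_chart \<Gamma> J \<gamma>" and bounds: "chart_bounds M \<kappa> J \<gamma>"
    and \<kappa>: "0 < \<kappa>" and M: "1 \<le> M" and S: "{p..p + h} \<subseteq> J" and "0 \<le> h"
    and L: "L = (1 + (M + 1) / \<kappa>) ^ CARD('n)" and h: "h \<le> 1 / (4 * L * M)"
    and box: "open_box_with_sides l B" and i: "i \<in> {1..CARD('n)}"
    and \<eta>: "0 < \<eta>" "\<eta> \<le> 1" "l i \<le> \<eta> ^ i"
  shows "\<exists>A\<in>lmeasurable. {s\<in>{p..p + h}. \<gamma> s \<in> B} \<subseteq> A \<and>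
           measure lebesgue A \<le> 2 ^ (CARD('n) + 1) * (4 * L * real CARD('n)) * \<eta>"
proof -
  let ?n = "CARD('n)"
  define v where "v j = vderiv j \<gamma> p" for j
  have p: "p \<in> J" using S \<open>0 \<le> h\<close> by auto
  have vM: "norm (v j) \<le> M" if "j \<in> {1..?n}" for j
    using bounds p that unfolding chart_bounds_def v_def by auto
  have v\<kappa>: "\<kappa> \<le> infdist (v j) (span (v ` {1..<j}))" if "j \<in> {1..?n}" for j
    using bounds p that unfolding chart_bounds_def v_def by auto
  have base: "1 \<le> 1 + (M + 1) / \<kappa>" using \<kappa> M by simp
  have L1: "1 \<le> L" unfolding L using base by (rule one_le_power)
  obtain c and u :: "nat \<Rightarrow> real ^ 'n"
    where cu: "\<And>x w. x \<in> B \<Longrightarrow> norm w = 1 \<Longrightarrow> (\<And>j. j \<in> {1..<i} \<Longrightarrow> w \<bullet> u j = 0)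
           \<Longrightarrow> \<bar>(x - c) \<bullet> w\<bar> < real ?n * \<eta> ^ i"
    using inner_small_in_box[OF box i \<eta>(3)] by metis
  have dim: "dim (v ` {1..i}) = i"
    using v\<kappa> i by (intro dim_span_of_infdist_pos[OF \<kappa>]) auto
  obtain w0 where w0: "w0 \<in> span (v ` {1..i})" "norm w0 = 1" "\<And>j. j \<in> {1..<i} \<Longrightarrow> w0 \<bullet> u j = 0"
    using unit_vector_in_span_orthogonal[OF dim] i by (metis atLeastAtMost_iff)
  have "\<exists>j\<in>{1..i}. 1 / (2 * L) < \<bar>v j \<bullet> w0\<bar>"
  proof (rule ccontr)
    assume "\<not> ?thesis"
    then have "\<bar>w0 \<bullet> w0\<bar> \<le> (1 + (M + 1) / \<kappa>) ^ i * (1 / (2 * L)) * norm w0"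
      using vM v\<kappa> i \<kappa> M L1 w0(1) by (intro inner_le_on_span[of \<kappa> M _ i v]) force+
    also have "\<dots> \<le> L * (1 / (2 * L)) * norm w0"
      unfolding L using base i L1[unfolded L]
      by (intro mult_right_mono power_increasing) auto
    also have "\<dots> = 1 / 2" using L1 w0(2) by simp
    finally show False using w0(2) by (simp add: dot_square_norm)
  qed
  then obtain j where j: "j \<in> {1..i}" "1 / (2 * L) < \<bar>v j \<bullet> w0\<bar>" by blast
  \<comment> \<open>The sign is chosen so that the derivative of order \<open>j\<close> of \<open>\<gamma> \<bullet> w\<close> is positive.\<close>
  define w where "w = (if 0 \<le> v j \<bullet> w0 then w0 else - w0)"
  have w: "norm w = 1" "\<And>j. j \<in> {1..<i} \<Longrightarrow> w \<bullet> u j = 0" "1 / (2 * L) < v j \<bullet> w"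
    using w0 j(2) unfolding w_def by auto
  define d where "d m s = (vderiv m \<gamma> s - (if m = 0 then c else 0)) \<bullet> w" for m s
  have der: "(d m has_real_derivative d (Suc m) s) (at s)" if "s \<in> {p..p + h}" "m \<le> ?n" for m s
    using that S by (intro chart_component_has_derivative[OF chart]) (auto simp: d_def fun_eq_iff)
  have lower: "1 / (4 * L) \<le> d j s" if s: "s \<in> {p..p + h}" for s
  proof (cases "s = p")
    case True
    have "1 / (4 * L) \<le> 1 / (2 * L)" using L1 by (simp add: field_simps)
    then show ?thesis using True w(3) j(1) unfolding d_def v_def by auto
  next
    case False
    have "\<exists>z. p < z \<and> z < s \<and> d j s - d j p = (s - p) * d (Suc j) z"
      using False s der j(1) i by (intro MVT2) auto
    then obtain z where z: "p < z" "z < s" "d j s - d j p = (s - p) * d (Suc j) z" by blast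
    have "z \<in> J" using z s S by auto
    then have "norm (vderiv (Suc j) \<gamma> z) \<le> M" using bounds j(1) i unfolding chart_bounds_def by auto
    then have "\<bar>d (Suc j) z\<bar> \<le> M"
      using Cauchy_Schwarz_ineq2[of "vderiv (Suc j) \<gamma> z" w] w(1) unfolding d_def by auto
    then have "\<bar>d j s - d j p\<bar> \<le> h * M"
      unfolding z(3) abs_mult using s by (intro mult_mono) auto
    also have "\<dots> \<le> 1 / (4 * L * M) * M" using h M by (intro mult_right_mono) auto
    also have "\<dots> = 1 / (4 * L)" using M by simp
    finally have "d j p - 1 / (4 * L) \<le> d j s" by linarith
    moreover have "1 / (2 * L) < d j p" using w(3) j(1) unfolding d_def v_def by auto
    moreover have "1 / (2 * L) = 1 / (4 * L) + 1 / (4 * L)" by simp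
    ultimately show ?thesis by linarith
  qed
  \<comment> \<open>Since \<open>j \<le> i\<close>, \<open>\<eta> \<le> 1\<close> and \<open>4 * L * n \<ge> 1\<close>, this \<open>t\<close> makes the sublevel \<open>t ^ j / (4 * L)\<close> at least
    the bound \<open>n * \<eta> ^ i\<close> for \<open>\<bar>(x - c) \<bullet> w\<bar>\<close> at points \<open>x\<close> of the box.\<close>
  define t where "t = 4 * L * real ?n * \<eta>"
  have n1: "1 \<le> real ?n" using i by auto
  have t0: "0 < t" unfolding t_def using L1 n1 \<eta>(1) by simp
  obtain A where A: "A \<in> lmeasurable" "{s\<in>{p..p + h}. \<bar>d 0 s\<bar> < 1 / (4 * L) * t ^ j} \<subseteq> A"
      "measure lebesgue A \<le> (2 ^ Suc j - 2) * t"
    using sublevel_set_small[of "{p..p + h}" "1 / (4 * L)" t j d] der lower L1 t0 j(1) i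
    by (auto simp: is_interval_cc)
  have T: "1 \<le> 4 * L * real ?n" using mult_mono[of 1 "4 * L" 1 "real ?n"] L1 n1 by auto
  have "real ?n * \<eta> ^ i = 1 / (4 * L) * (4 * L * real ?n * \<eta> ^ i)" using L1 by simp
  also have "\<dots> \<le> 1 / (4 * L) * ((4 * L * real ?n) ^ j * \<eta> ^ j)"
  proof (intro mult_left_mono mult_mono)
    show "4 * L * real ?n \<le> (4 * L * real ?n) ^ j"
      using T j(1) self_le_power[of "4 * L * real ?n" j] by auto
    show "\<eta> ^ i \<le> \<eta> ^ j" using \<eta> j(1) by (intro power_decreasing) auto
  qed (use L1 T \<eta> in auto)
  also have "\<dots> = 1 / (4 * L) * t ^ j" unfolding t_def by (simp add: power_mult_distrib)
  finally have le: "real ?n * \<eta> ^ i \<le> 1 / (4 * L) * t ^ j" .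
  have "{s\<in>{p..p + h}. \<gamma> s \<in> B} \<subseteq> {s\<in>{p..p + h}. \<bar>d 0 s\<bar> < 1 / (4 * L) * t ^ j}"
    using cu[OF _ w(1) w(2)] le unfolding d_def by (auto intro: less_le_trans)
  then have sub: "{s\<in>{p..p + h}. \<gamma> s \<in> B} \<subseteq> A" using A(2) by blast
  have "(2::real) ^ Suc j \<le> 2 ^ (?n + 1)" using j(1) i by (intro power_increasing) auto
  then have "(2::real) ^ Suc j - 2 \<le> 2 ^ (?n + 1)" by linarith
  then have "(2 ^ Suc j - 2) * t \<le> 2 ^ (?n + 1) * t" using t0 by (intro mult_right_mono) simp_all
  then have "measure lebesgue A \<le> 2 ^ (?n + 1) * t" using A(3) by linarith
  also have "\<dots> = 2 ^ (?n + 1) * (4 * L * real ?n) * \<eta>" unfolding t_def by (simp only: mult.assoc)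
  finally show ?thesis using A(1) sub by blast
qed

text \<open>
  The boxes of the cover capture all parameters of an arc of length \<open>h\<close>, but each of them only a set
  of measure at most a multiple of \<open>\<eta>\<close>.
\<close>
lemma box_cover_card_ge:
  fixes \<Gamma> :: "(real ^ 'n) set"
  assumes ud: "uniform_data \<Gamma> K r M \<kappa>" and "\<Gamma> \<noteq> {}" and \<delta>: "\<delta> \<in> Delta CARD('n)"
    and L: "L = (1 + (M + 1) / \<kappa>) ^ CARD('n)" and h: "h = min (r / 2) (1 / (4 * L * M))"
    and i: "i \<in> {1..CARD('n)}" and \<eta>: "0 < \<eta>" "\<eta> \<le> 1" "\<delta> i = \<eta> ^ i"
    and cover: "finite \<B>" "box_cover \<delta> \<Gamma> \<B>"
  shows "h \<le> real (card \<B>) * (2 ^ (CARD('n) + 1) * (4 * L * real CARD('n)) * \<eta>)"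
proof -
  obtain J \<gamma> where r: "0 < r" and \<kappa>: "0 < \<kappa>" and \<Gamma>: "\<Gamma> = (\<Union>k<K. \<gamma> k ` J k)"
    and all: "\<And>k. k < K \<Longrightarrow> unit_speed_chart \<Gamma> (J k) (\<gamma> k) \<and> J k \<in> centred_intervals r \<and>
              chart_bounds M \<kappa> (J k) (\<gamma> k)"
    using ud unfolding uniform_data_iff by blast
  have "0 < K" using assms(2) \<Gamma> by (cases K) auto
  note chart = all[OF this, THEN conjunct1] and cen = all[OF this, THEN conjunct2, THEN conjunct1]
    and bounds = all[OF this, THEN conjunct2, THEN conjunct2]
  have M: "1 \<le> M"
    using one_le_bound_of_unit_speed[OF chart bounds] centred_interval_props(3)[OF cen r] by blast
  have L1: "1 \<le> L" unfolding L using \<kappa> M by (intro one_le_power) simp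
  have h0: "0 < h" "h < r" "h \<le> 1 / (4 * L * M)"
  proof -
    have "0 < 1 / (4 * L * M)" using L1 M by simp
    then show "0 < h" unfolding h using r by (simp only: min_less_iff_conj) simp
    have "h \<le> r / 2" unfolding h by (rule min.cobounded1)
    then show "h < r" using r by simp
    show "h \<le> 1 / (4 * L * M)" unfolding h by (rule min.cobounded2)
  qed
  \<comment> \<open>Since \<open>h < r\<close>, the arc fits on one side of the centre of the chart, also at a boundary point.\<close>
  have "\<exists>p. {p..p + h} \<subseteq> J 0"
  proof (cases "J 0 = {-r<..0}")
    case True
    have "{-h..-h + h} \<subseteq> J 0" unfolding True using h0(1,2) by auto
    then show ?thesis by blast
  next
    case False
    then have "J 0 = {-r<..<r} \<or> J 0 = {0..<r}" using cen unfolding centred_intervals_def by blast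
    then have "{0..0 + h} \<subseteq> J 0"
    proof
      assume "J 0 = {-r<..<r}"
      show ?thesis unfolding \<open>J 0 = _\<close> using h0(1,2) by auto
    next
      assume "J 0 = {0..<r}"
      show ?thesis unfolding \<open>J 0 = _\<close> using h0(1,2) by auto
    qed
    then show ?thesis by blast
  qed
  then obtain p where p: "{p..p + h} \<subseteq> J 0" by blast
  define c where "c = 2 ^ (CARD('n) + 1) * (4 * L * real CARD('n)) * \<eta>"
  have "\<exists>A\<in>lmeasurable. {s\<in>{p..p + h}. \<gamma> 0 s \<in> B} \<subseteq> A \<and> measure lebesgue A \<le> c" if B: "B \<in> \<B>" for B
  proof -
    obtain l where l: "open_box_with_sides l B" "l i \<le> \<delta> i"
      using cover(2) B i unfolding box_cover_def by blast
    then show ?thesis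
      unfolding c_def using \<eta>(3) h0
      by (intro box_preimage_small[OF chart bounds \<kappa> M p _ L h0(3) l(1) i \<eta>(1,2)]) auto
  qed
  then obtain A where A: "\<And>B. B \<in> \<B> \<Longrightarrow> A B \<in> lmeasurable"
      "\<And>B. B \<in> \<B> \<Longrightarrow> {s\<in>{p..p + h}. \<gamma> 0 s \<in> B} \<subseteq> A B"
      "\<And>B. B \<in> \<B> \<Longrightarrow> measure lebesgue (A B) \<le> c"
    by metis
  have "{p..p + h} \<subseteq> (\<Union>B\<in>\<B>. A B)"
  proof
    fix s assume s: "s \<in> {p..p + h}"
    then have "\<gamma> 0 s \<in> \<gamma> 0 ` J 0" using p by blast
    then have "\<gamma> 0 s \<in> \<Gamma>" unfolding \<Gamma> using \<open>0 < K\<close> by blast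
    then obtain B where "B \<in> \<B>" "\<gamma> 0 s \<in> B" using cover(2) unfolding box_cover_def by blast
    then show "s \<in> (\<Union>B\<in>\<B>. A B)" using A(2) s by blast
  qed
  moreover have "(\<Union>B\<in>\<B>. A B) \<in> lmeasurable"
    using cover(1) A(1) by (intro fmeasurable.finite_UN) auto
  ultimately have "measure lebesgue {p..p + h} \<le> measure lebesgue (\<Union>B\<in>\<B>. A B)"
    by (intro measure_mono_fmeasurable) auto
  also have "\<dots> \<le> (\<Sum>B\<in>\<B>. measure lebesgue (A B))"
    using A(1) by (intro measure_UNION_le[OF cover(1)]) auto
  also have "\<dots> \<le> (\<Sum>B\<in>\<B>. c)" by (intro sum_mono A(3))
  finally show ?thesis using h0 by (simp add: c_def)
qed

section \<open>Two-sided bounds for the box number\<close>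

lemma Min_root_Delta:
  assumes \<delta>: "\<delta> \<in> Delta n" and "1 \<le> n"
    and \<eta>: "\<eta> = (MIN i\<in>{1..n}. \<delta> i powr (1 / real i))"
  shows "0 < \<eta>" and "\<eta> \<le> 1"
    and "\<And>i. i \<in> {1..n} \<Longrightarrow> \<eta> ^ i \<le> \<delta> i"
    and "\<exists>i\<in>{1..n}. \<delta> i = \<eta> ^ i"
proof -
  let ?R = "(\<lambda>i. \<delta> i powr (1 / real i)) ` {1..n}"
  have fin: "finite ?R" "?R \<noteq> {}" using assms(2) by auto
  have pos: "0 < \<delta> i" "\<delta> i < 1" if "i \<in> {1..n}" for i using \<delta> that by (auto simp: Delta_def)
  have root: "(\<delta> i powr (1 / real i)) ^ i = \<delta> i" if "i \<in> {1..n}" for i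
    using pos(1)[OF that] that by (simp add: powr_realpow[symmetric] powr_powr)
  have in_R: "\<eta> \<in> ?R" unfolding \<eta> by (rule Min_in[OF fin])
  then obtain i where i: "i \<in> {1..n}" "\<eta> = \<delta> i powr (1 / real i)" by auto
  show "0 < \<eta>" using i(2) pos(1)[OF i(1)] by simp
  show "\<eta> \<le> 1" unfolding i(2) using pos[OF i(1)] by (intro powr_le1) auto
  show "\<exists>i\<in>{1..n}. \<delta> i = \<eta> ^ i" using i root by (intro bexI[of _ i]) auto
  show "\<eta> ^ i \<le> \<delta> i" if "i \<in> {1..n}" for i
  proof -
    have "\<eta> \<le> \<delta> i powr (1 / real i)" unfolding \<eta> using fin that by (intro Min_le) auto
    then have "\<eta> ^ i \<le> (\<delta> i powr (1 / real i)) ^ i" using \<open>0 < \<eta>\<close> by (intro power_mono) auto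
    then show ?thesis using root[OF that] by simp
  qed
qed

text \<open>
  The constants of the final theorem are to be chosen for all values \<open>K\<close>, \<open>r\<close>, \<open>M\<close>, \<open>\<kappa>\<close>. The last
  three conclusions single out the values for which the formulas for the constants are meaningful,
  as no curve has any other data.
\<close>
lemma box_number_bounds:
  fixes \<Gamma> :: "(real ^ 'n) set"
  assumes ud: "uniform_data \<Gamma> K r M \<kappa>" and ne: "\<Gamma> \<noteq> {}" and \<delta>: "\<delta> \<in> Delta CARD('n)"
    and L: "L = (1 + (M + 1) / \<kappa>) ^ CARD('n)" and h: "h = min (r / 2) (1 / (4 * L * M))"
    and \<eta>: "\<eta> = (MIN i\<in>{1..CARD('n)}. \<delta> i powr (1 / real i))"
  shows "h / (2 ^ (CARD('n) + 1) * (4 * L * real CARD('n))) * inverse \<eta> \<le> real (box_number \<Gamma> \<delta>)"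
    and "real (box_number \<Gamma> \<delta>) \<le> real K * (2 * r * (2 * M + 1) + 1) * inverse \<eta>"
    and "0 < r" and "0 < \<kappa>" and "1 \<le> M"
proof -
  let ?n = "CARD('n)"
  let ?P = "\<lambda>m. \<exists>\<B>. finite \<B> \<and> card \<B> = m \<and> box_cover \<delta> \<Gamma> \<B>"
  obtain J \<gamma> where r: "0 < r" and \<kappa>: "0 < \<kappa>" and \<Gamma>: "\<Gamma> = (\<Union>k<K. \<gamma> k ` J k)"
    and all: "\<And>k. k < K \<Longrightarrow> unit_speed_chart \<Gamma> (J k) (\<gamma> k) \<and> J k \<in> centred_intervals r \<and>
              chart_bounds M \<kappa> (J k) (\<gamma> k)"
    using ud unfolding uniform_data_iff by blast
  show "0 < r" "0 < \<kappa>" by fact+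
  have "0 < K" using ne \<Gamma> by (cases K) auto
  then show M: "1 \<le> M"
    using one_le_bound_of_unit_speed all centred_interval_props(3)[OF _ r] by (metis empty_iff)
  have "1 \<le> ?n" by (simp add: Suc_leI)
  note \<eta>s = Min_root_Delta[OF \<delta> this \<eta>]
  \<comment> \<open>The cell length \<open>g\<close>: the denominator is at least 1 and exceeds \<open>2 * M\<close>, whence \<open>2 * M * g ^ i < \<eta> ^ i\<close>.\<close>
  define g where "g = \<eta> / (2 * M + 1)"
  have g0: "0 < g" unfolding g_def using \<eta>s(1) M by simp
  have g: "2 * M * g ^ i < \<delta> i" if i: "i \<in> {1..?n}" for i
  proof -
    have "2 * M + 1 \<le> (2 * M + 1) ^ i" using M i by (intro self_le_power) auto
    then have "g ^ i \<le> \<eta> ^ i / (2 * M + 1)"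
      unfolding g_def power_divide using \<eta>s(1) M by (intro divide_left_mono) auto
    then have "2 * M * g ^ i \<le> 2 * M * (\<eta> ^ i / (2 * M + 1))"
      using M by (intro mult_left_mono) auto
    also have "\<dots> < \<eta> ^ i" using \<eta>s(1) M by (simp add: field_simps)
    also have "\<dots> \<le> \<delta> i" using \<eta>s(3) i by simp
    finally show ?thesis .
  qed
  obtain \<B> where \<B>: "finite \<B>" "real (card \<B>) \<le> real K * (2 * r / g + 1)" "box_cover \<delta> \<Gamma> \<B>"
    using box_cover_exists[OF ud \<delta> g0 g] by blast
  have "box_number \<Gamma> \<delta> \<le> card \<B>"
    unfolding box_number_def by (rule Least_le) (use \<B> in blast)
  then have "real (box_number \<Gamma> \<delta>) \<le> real K * (2 * r / g + 1)" using \<B>(2) by linarith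
  also have "\<dots> \<le> real K * (2 * r / g + inverse \<eta>)"
    using \<eta>s(1,2) by (intro mult_left_mono add_left_mono) (auto simp: one_le_inverse_iff)
  also have "\<dots> = real K * (2 * r * (2 * M + 1) + 1) * inverse \<eta>"
    unfolding g_def using \<eta>s(1) M by (simp add: field_simps)
  finally show "real (box_number \<Gamma> \<delta>) \<le> real K * (2 * r * (2 * M + 1) + 1) * inverse \<eta>" .
  have "?P (box_number \<Gamma> \<delta>)"
    unfolding box_number_def by (rule LeastI[of ?P "card \<B>"]) (use \<B> in blast)
  then obtain \<C> where \<C>: "finite \<C>" "card \<C> = box_number \<Gamma> \<delta>" "box_cover \<delta> \<Gamma> \<C>" by blast
  obtain i where i: "i \<in> {1..?n}" "\<delta> i = \<eta> ^ i" using \<eta>s(4) by blast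
  define c where "c = 2 ^ (?n + 1) * (4 * L * real ?n)"
  have "h \<le> real (card \<C>) * (c * \<eta>)"
    unfolding c_def by (rule box_cover_card_ge[OF ud ne \<delta> L h i(1) \<eta>s(1,2) i(2) \<C>(1,3)])
  moreover have "0 < c" unfolding c_def L using \<kappa> M by (simp add: add_pos_pos)
  ultimately have "h / c * inverse \<eta> \<le> real (box_number \<Gamma> \<delta>)"
    unfolding \<C>(2) using \<eta>s(1) by (simp add: field_simps)
  then show "h / (2 ^ (?n + 1) * (4 * L * real ?n)) * inverse \<eta> \<le> real (box_number \<Gamma> \<delta>)"
    unfolding c_def .
qed

section \<open>Translation and restriction of charts\<close>

lemma has_vector_derivative_translate:
  fixes f :: "real \<Rightarrow> 'a::real_normed_vector"
  shows "((\<lambda>t. f (t + a)) has_vector_derivative D) (at t) \<longleftrightarrow> (f has_vector_derivative D) (at (t + a))"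
proof -
  have shift: "((\<lambda>t. g (t + b)) has_vector_derivative D) (at x)"
    if "(g has_vector_derivative D) (at (x + b))" for g :: "real \<Rightarrow> 'a" and b x
  proof -
    have "((\<lambda>t. t + b) has_vector_derivative 1) (at x)"
      by (auto intro!: derivative_eq_intros)
    from vector_diff_chain_at[OF this that] show ?thesis by (simp add: o_def)
  qed
  show ?thesis
    using shift[of f t a] shift[of "\<lambda>t. f (t + a)" "t + a" "- a"] by auto
qed

lemma vderiv_translate: "vderiv k (\<lambda>t. f (t + a)) t = vderiv k f (t + a)"
proof (induction k arbitrary: t)
  case (Suc k)
  then have "vderiv k (\<lambda>t. f (t + a)) = (\<lambda>t. vderiv k f (t + a))" by auto
  then show ?case
    unfolding vderiv_Suc vector_derivative_def by (simp add: has_vector_derivative_translate)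
qed simp

lemma unit_speed_chart_translate:
  fixes \<gamma> :: "real \<Rightarrow> real ^ 'n"
  assumes "unit_speed_chart \<Gamma> J \<gamma>"
  shows "unit_speed_chart \<Gamma> {t. t + a \<in> J} (\<lambda>t. \<gamma> (t + a))"
proof -
  obtain I g where J: "is_interval J" "interior J \<noteq> {}"
    and I: "open I" "is_interval I" "J \<subseteq> I" "C_k_on (CARD('n) + 1) \<gamma> I"
    and speed: "\<And>s. s \<in> J \<Longrightarrow> norm (vderiv 1 \<gamma> s) = 1"
    and op: "openin (top_of_set \<Gamma>) (\<gamma> ` J)" and hom: "homeomorphism J (\<gamma> ` J) \<gamma> g"
    using assms unfolding unit_speed_chart_def by blast
  let ?T = "\<lambda>S. {t. t + a \<in> S}"
  have shift: "vderiv j (\<lambda>t. \<gamma> (t + a)) = (\<lambda>t. vderiv j \<gamma> (t + a))" for j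
    by (rule ext) (rule vderiv_translate)
  have open_T: "open (?T U)" if "open U" for U :: "real set"
  proof -
    have "open ((\<lambda>t. t + a) -` U)" by (intro open_vimage that continuous_intros)
    then show ?thesis by (simp add: vimage_def)
  qed
  have interval_T: "is_interval (?T S)" if "is_interval S" for S
    using that unfolding is_interval_1 by (metis add_right_mono mem_Collect_eq)
  have "?T (interior J) \<subseteq> interior (?T J)"
    using open_T interior_subset by (intro interior_maximal) blast+
  moreover obtain x where "x \<in> interior J" using J(2) by blast
  then have "x - a \<in> ?T (interior J)" by simp
  ultimately have int: "interior (?T J) \<noteq> {}" by blast
  have "C_k_on (CARD('n) + 1) (\<lambda>t. \<gamma> (t + a)) (?T I)"
    unfolding C_k_on_def shift
  proof (intro conjI allI impI ballI)
    fix j t assume "j < CARD('n) + 1" "t \<in> ?T I"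
    then have "(vderiv j \<gamma> has_vector_derivative vector_derivative (vderiv j \<gamma>) (at (t + a))) (at (t + a))"
      using I(4) unfolding C_k_on_def by (auto simp: vector_derivative_works)
    then have "((\<lambda>t. vderiv j \<gamma> (t + a)) has_vector_derivative
        vector_derivative (vderiv j \<gamma>) (at (t + a))) (at t)"
      by (simp add: has_vector_derivative_translate)
    then show "(\<lambda>t. vderiv j \<gamma> (t + a)) differentiable (at t)" by (rule differentiableI_vector)
  next
    have top: "continuous_on I (vderiv (CARD('n) + 1) \<gamma>)" using I(4) unfolding C_k_on_def by blast
    show "continuous_on (?T I) (\<lambda>t. vderiv (CARD('n) + 1) \<gamma> (t + a))"
      by (rule continuous_on_compose2[OF top]) (auto intro!: continuous_intros)
  qed
  then have ext: "\<exists>I. open I \<and> is_interval I \<and> ?T J \<subseteq> I \<and> C_k_on (CARD('n) + 1) (\<lambda>t. \<gamma> (t + a)) I"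
    using open_T[OF I(1)] interval_T[OF I(2)] I(3) by (intro exI[of _ "?T I"]) auto
  have img_T: "(\<lambda>t. t + a) ` ?T J = J"
  proof
    show "J \<subseteq> (\<lambda>t. t + a) ` ?T J"
      by (rule subsetI, rule image_eqI[where x = "_ - a"]) auto
  qed auto
  then have img: "(\<lambda>t. \<gamma> (t + a)) ` ?T J = \<gamma> ` J" by (metis image_image)
  have "homeomorphism (?T J) J (\<lambda>t. t + a) (\<lambda>s. s - a)"
    by (intro homeomorphismI continuous_intros) (auto simp: img_T)
  from homeomorphism_compose[OF this hom]
  have "\<exists>g. homeomorphism (?T J) (\<gamma> ` J) (\<lambda>t. \<gamma> (t + a)) g" by (auto simp: o_def)
  then show ?thesis
    unfolding unit_speed_chart_def img shift
    using interval_T[OF J(1)] int ext speed op by auto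
qed

lemma unit_speed_chart_restrict:
  assumes "unit_speed_chart \<Gamma> J \<gamma>" and "openin (top_of_set J) J'"
    and "is_interval J'" and "interior J' \<noteq> {}"
  shows "unit_speed_chart \<Gamma> J' \<gamma>"
proof -
  obtain g where op: "openin (top_of_set \<Gamma>) (\<gamma> ` J)" and hom: "homeomorphism J (\<gamma> ` J) \<gamma> g"
    using assms(1) unfolding unit_speed_chart_def by blast
  have sub: "J' \<subseteq> J" using assms(2) by (rule openin_imp_subset)
  have "openin (top_of_set \<Gamma>) (\<gamma> ` J')"
    using homeomorphism_imp_open_map[OF hom assms(2)] op by (rule openin_trans)
  moreover have "homeomorphism J' (\<gamma> ` J') \<gamma> g"
    using homeomorphism_of_subsets[OF hom sub] sub by blast
  ultimately show ?thesis
    using assms(1,3,4) sub unfolding unit_speed_chart_def by blast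
qed

lemma chart_vderiv_continuous:
  fixes \<gamma> :: "real \<Rightarrow> real ^ 'n"
  assumes "unit_speed_chart \<Gamma> J \<gamma>" and "i \<le> CARD('n) + 1"
  shows "continuous_on J (vderiv i \<gamma>)"
proof (cases "i = CARD('n) + 1")
  case True
  then show ?thesis
    using assms(1) continuous_on_subset unfolding unit_speed_chart_def C_k_on_def by blast
next
  case False
  then have "i \<le> CARD('n)" using assms(2) by simp
  then show ?thesis
    using chart_has_vector_derivative[OF assms(1)] has_vector_derivative_continuous
    by (intro continuous_at_imp_continuous_on) blast
qed

section \<open>Uniform bounds from the determinant condition\<close>

lemma deriv_matrix_mult:
  fixes \<gamma> :: "real \<Rightarrow> real ^ 'n"
  shows "deriv_matrix \<gamma> s *v x =
    (\<Sum>j\<in>UNIV. x $ j *\<^sub>R vderiv (Suc (to_nat_on (UNIV :: 'n set) j)) \<gamma> s)"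
  by (simp add: vec_eq_iff deriv_matrix_def matrix_vector_mult_def mult.commute)

text \<open>
  The norm of \<open>deriv_matrix \<gamma> s *v x\<close> is continuous in the pair \<open>(s, x)\<close> and does not vanish for unit
  vectors \<open>x\<close>, so it has a positive minimum over the compact product of \<open>C\<close> and the unit sphere.
\<close>
lemma deriv_matrix_bounded_below:
  fixes \<gamma> :: "real \<Rightarrow> real ^ 'n"
  assumes "compact C" and det: "\<And>s. s \<in> C \<Longrightarrow> det (deriv_matrix \<gamma> s) \<noteq> 0"
    and cont: "\<And>i. i \<in> {1..CARD('n)} \<Longrightarrow> continuous_on C (vderiv i \<gamma>)"
  obtains \<kappa> where "0 < \<kappa>" and "\<And>s x. s \<in> C \<Longrightarrow> \<kappa> * norm x \<le> norm (deriv_matrix \<gamma> s *v x)"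
proof (cases "C = {}")
  case True
  then show thesis by (intro that[of 1]) auto
next
  case False
  let ?S = "C \<times> sphere (0 :: real ^ 'n) 1"
  let ?f = "\<lambda>(s, x). norm (deriv_matrix \<gamma> s *v x)"
  have "continuous_on ?S (\<lambda>q. vderiv (Suc (to_nat_on (UNIV :: 'n set) j)) \<gamma> (fst q))" for j
  proof (rule continuous_on_compose2[OF cont])
    have "to_nat_on (UNIV :: 'n set) j < CARD('n)"
      using bij_betwE[OF to_nat_on_finite[of "UNIV :: 'n set"]] by auto
    then show "Suc (to_nat_on (UNIV :: 'n set) j) \<in> {1..CARD('n)}" by simp
  qed (auto intro: continuous_intros)
  then have "continuous_on ?S ?f"
    unfolding deriv_matrix_mult case_prod_unfold by (intro continuous_intros)
  moreover have "compact ?S" using assms(1) by (intro compact_Times) auto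
  moreover have "axis undefined 1 \<in> sphere (0 :: real ^ 'n) 1" by simp
  then have "?S \<noteq> {}" using False by blast
  ultimately obtain q where q: "q \<in> ?S" "\<And>y. y \<in> ?S \<Longrightarrow> ?f q \<le> ?f y"
    using continuous_attains_inf[of ?S ?f] by blast
  obtain s0 x0 where q0: "q = (s0, x0)" "s0 \<in> C" "norm x0 = 1" using q(1) by (cases q) auto
  have inj: "x = 0" if "s \<in> C" "deriv_matrix \<gamma> s *v x = 0" for s x
    using det[OF that(1)] that(2) matrix_left_invertible_ker[of "deriv_matrix \<gamma> s"]
    by (metis invertible_det_nz invertible_left_inverse)
  show thesis
  proof (rule that[of "norm (deriv_matrix \<gamma> s0 *v x0)"])
    show "0 < norm (deriv_matrix \<gamma> s0 *v x0)" using inj q0 by fastforce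
    fix s x assume s: "s \<in> C"
    show "norm (deriv_matrix \<gamma> s0 *v x0) * norm x \<le> norm (deriv_matrix \<gamma> s *v x)"
    proof (cases "x = 0")
      case nz: False
      have "(s, (1 / norm x) *\<^sub>R x) \<in> ?S" using s nz by simp
      then have "norm (deriv_matrix \<gamma> s0 *v x0) \<le> norm (deriv_matrix \<gamma> s *v ((1 / norm x) *\<^sub>R x))"
        using q(2) unfolding q0(1) by fastforce
      also have "\<dots> = norm (deriv_matrix \<gamma> s *v x) / norm x"
        by (simp add: matrix_vector_mult_scaleR)
      finally show ?thesis using nz by (simp add: field_simps)
    qed simp
  qed
qed

text \<open>
  The difference of the \<open>i\<close>-th derivative and a combination of the earlier ones is the image of a
  coefficient vector that has \<open>1\<close> as its component at the index of order \<open>i\<close>, hence norm at least 1.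
  This gives a lower bound for all distances at once, although the spans vary with \<open>s\<close>.
\<close>
lemma infdist_ge_of_deriv_matrix_ge:
  fixes \<gamma> :: "real \<Rightarrow> real ^ 'n"
  assumes "0 \<le> \<kappa>" and lower: "\<And>x. \<kappa> * norm x \<le> norm (deriv_matrix \<gamma> s *v x)"
    and i: "i \<in> {1..CARD('n)}"
  shows "\<kappa> \<le> infdist (vderiv i \<gamma> s) (span ((\<lambda>j. vderiv j \<gamma> s) ` {1..<i}))"
proof -
  let ?A = "deriv_matrix \<gamma> s" and ?e = "\<lambda>j. axis j 1 :: real ^ 'n"
  have idx: "\<exists>j. k = Suc (to_nat_on (UNIV :: 'n set) j) \<and> ?A *v ?e j = vderiv k \<gamma> s"
    if k: "k \<in> {1..CARD('n)}" for k
  proof -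
    have "k - 1 \<in> to_nat_on (UNIV :: 'n set) ` UNIV"
      using bij_betw_imp_surj_on[OF to_nat_on_finite[of "UNIV :: 'n set"]] k by auto
    then obtain j where "k - 1 = to_nat_on (UNIV :: 'n set) j" by blast
    then have "k = Suc (to_nat_on (UNIV :: 'n set) j)" using k by auto
    then show ?thesis
      by (intro exI[of _ j]) (simp add: matrix_vector_mult_basis column_def deriv_matrix_def vec_eq_iff)
  qed
  obtain j0 where j0: "i = Suc (to_nat_on UNIV j0)" "?A *v ?e j0 = vderiv i \<gamma> s" using idx[OF i] by blast
  \<comment> \<open>The combinations of all derivatives of orders other than \<open>i\<close>, among them the span in question.\<close>
  define Y where "Y = (\<lambda>x. ?A *v x) ` {x. x $ j0 = 0}"
  have "subspace {x :: real ^ 'n. x $ j0 = 0}" by (auto simp: subspace_def)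
  then have "subspace Y"
    unfolding Y_def by (intro linear_subspace_image matrix_vector_mul_linear)
  moreover have "(\<lambda>j. vderiv j \<gamma> s) ` {1..<i} \<subseteq> Y"
  proof
    fix y assume "y \<in> (\<lambda>j. vderiv j \<gamma> s) ` {1..<i}"
    then obtain k where k: "k \<in> {1..<i}" "y = vderiv k \<gamma> s" by blast
    then obtain j where j: "k = Suc (to_nat_on UNIV j)" "?A *v ?e j = y" using idx[of k] i by auto
    then have "j \<noteq> j0" using j0(1) k(1) by auto
    then have "?e j $ j0 = 0" by (simp add: axis_def)
    then show "y \<in> Y" unfolding Y_def using j(2) by blast
  qed
  ultimately have span: "span ((\<lambda>j. vderiv j \<gamma> s) ` {1..<i}) \<subseteq> Y" by (intro span_minimal)
  have dist: "\<kappa> \<le> dist (vderiv i \<gamma> s) y" if "y \<in> span ((\<lambda>j. vderiv j \<gamma> s) ` {1..<i})" for y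
  proof -
    obtain x where x: "x $ j0 = 0" "y = ?A *v x" using span \<open>y \<in> _\<close> unfolding Y_def by blast
    have "1 \<le> \<bar>(?e j0 - x) $ j0\<bar>" using x(1) by simp
    also have "\<dots> \<le> norm (?e j0 - x)" by (rule component_le_norm_cart)
    finally have "\<kappa> * 1 \<le> \<kappa> * norm (?e j0 - x)" using assms(1) by (rule mult_left_mono)
    also have "\<dots> \<le> norm (?A *v (?e j0 - x))" by (rule lower)
    also have "\<dots> = dist (vderiv i \<gamma> s) y"
      unfolding x(2) j0(2)[symmetric] dist_norm by (simp add: matrix_vector_mult_diff_distrib)
    finally show ?thesis by simp
  qed
  have "span ((\<lambda>j. vderiv j \<gamma> s) ` {1..<i}) \<noteq> {}" using span_zero by blast
  then show ?thesis
    unfolding infdist_notempty[OF \<open>span _ \<noteq> {}\<close>] using dist by (intro cINF_greatest)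
qed

lemma chart_bounds_on_compact:
  fixes \<gamma> :: "real \<Rightarrow> real ^ 'n"
  assumes chart: "unit_speed_chart \<Gamma> J \<gamma>" and det: "\<And>s. s \<in> J \<Longrightarrow> det (deriv_matrix \<gamma> s) \<noteq> 0"
    and "compact C" and "C \<subseteq> J"
  obtains M \<kappa> where "0 < \<kappa>" and "chart_bounds M \<kappa> C \<gamma>"
proof -
  have cont: "continuous_on C (vderiv i \<gamma>)" if "i \<le> CARD('n) + 1" for i
    using chart_vderiv_continuous[OF chart that] assms(4) by (rule continuous_on_subset)
  have "continuous_on C (vderiv i \<gamma>)" if "i \<in> {1..CARD('n)}" for i using cont that by simp
  moreover have "det (deriv_matrix \<gamma> s) \<noteq> 0" if "s \<in> C" for s using det assms(4) that by blast
  ultimately obtain \<kappa>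
    where \<kappa>: "0 < \<kappa>" "\<And>s x. s \<in> C \<Longrightarrow> \<kappa> * norm x \<le> norm (deriv_matrix \<gamma> s *v x)"
    using deriv_matrix_bounded_below[OF assms(3), of \<gamma>] by blast
  have "\<exists>b. \<forall>s\<in>C. norm (vderiv i \<gamma> s) \<le> b" if "i \<le> CARD('n) + 1" for i
    using compact_imp_bounded[OF compact_continuous_image[OF cont[OF that] assms(3)]]
    by (auto simp: bounded_iff)
  then obtain b where b: "\<And>i s. i \<le> CARD('n) + 1 \<Longrightarrow> s \<in> C \<Longrightarrow> norm (vderiv i \<gamma> s) \<le> b i" by metis
  define M where "M = Max (b ` {..CARD('n) + 1})"
  have "b i \<le> M" if "i \<le> CARD('n) + 1" for i unfolding M_def using that by (intro Max_ge) auto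
  then have "norm (vderiv i \<gamma> s) \<le> M" if "i \<le> CARD('n) + 1" "s \<in> C" for i s
    using b that by (meson order_trans)
  then have "chart_bounds M \<kappa> C \<gamma>"
    unfolding chart_bounds_def
    using infdist_ge_of_deriv_matrix_ge[OF less_imp_le[OF \<kappa>(1)] \<kappa>(2)] by auto
  then show thesis using \<kappa>(1) that by blast
qed

section \<open>Existence of uniform data\<close>

text \<open>
  The compact set \<open>C\<close> between the shortened interval and \<open>J\<close> makes uniform bounds on the
  shortened interval available, which need not exist on \<open>J\<close> itself.
\<close>
lemma interval_near_zero:
  assumes "is_interval J" and "interior J \<noteq> {}" and "0 \<in> J"
  obtains \<rho> C where "0 < \<rho>" and "J \<inter> {-\<rho><..<\<rho>} \<in> centred_intervals \<rho>"
    and "compact C" and "J \<inter> {-\<rho><..<\<rho>} \<subseteq> C" and "C \<subseteq> J"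
proof -
  have between: "z \<in> J" if "x \<in> J" "y \<in> J" "x \<le> z" "z \<le> y" for x y z
    using assms(1) that by (meson mem_is_interval_1_I)
  consider (both) x y where "x \<in> J" "x < 0" "y \<in> J" "0 < y"
    | (right) y where "y \<in> J" "0 < y" "\<And>z. z \<in> J \<Longrightarrow> 0 \<le> z"
    | (left) x where "x \<in> J" "x < 0" "\<And>z. z \<in> J \<Longrightarrow> z \<le> 0"
    | (trivial) "J \<subseteq> {0}"
    by (metis linorder_not_less singletonI subsetI order_antisym)
  then show thesis
  proof cases
    case both
    define \<rho> where "\<rho> = min (- x) y"
    have \<rho>: "0 < \<rho>" "x \<le> - \<rho>" "\<rho> \<le> y" unfolding \<rho>_def using both by auto
    have C: "{-\<rho>..\<rho>} \<subseteq> J" using between[OF both(1,3)] \<rho> by auto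
    then have "J \<inter> {-\<rho><..<\<rho>} = {-\<rho><..<\<rho>}" by auto
    then show thesis using \<rho>(1) C
      by (intro that[of \<rho> "{-\<rho>..\<rho>}"]) (auto simp: centred_intervals_def)
  next
    case right
    have C: "{0..y} \<subseteq> J" using between[OF assms(3) right(1)] by auto
    then have "J \<inter> {-y<..<y} = {0..<y}" using right by force
    then show thesis using right(2) C
      by (intro that[of y "{0..y}"]) (auto simp: centred_intervals_def)
  next
    case left
    have C: "{x..0} \<subseteq> J" using between[OF left(1) assms(3)] by auto
    then have "J \<inter> {-(-x)<..<-x} = {-(-x)<..0}" using left by force
    then show thesis using left(2) C
      by (intro that[of "-x" "{x..0}"]) (auto simp: centred_intervals_def)
  next
    case trivial
    then have "interior J \<subseteq> interior {0}" by (rule interior_mono)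
    then show thesis using assms(2) by simp
  qed
qed

lemma local_chart:
  fixes \<Gamma> :: "(real ^ 'n) set"
  assumes "nondegenerate_curve \<Gamma>" and "p \<in> \<Gamma>"
  shows "\<exists>J \<gamma> \<rho> M \<kappa>. 0 < \<rho> \<and> 0 < \<kappa> \<and> unit_speed_chart \<Gamma> J \<gamma> \<and> J \<in> centred_intervals \<rho> \<and>
           chart_bounds M \<kappa> J \<gamma> \<and> \<gamma> 0 = p"
proof -
  obtain J0 \<gamma>0 a where chart0: "unit_speed_chart \<Gamma> J0 \<gamma>0" and a: "a \<in> J0" "p = \<gamma>0 a"
    using assms unfolding nondegenerate_curve_def compact_embedded_curve_def by blast
  define J where "J = {t. t + a \<in> J0}"
  define \<gamma> where "\<gamma> t = \<gamma>0 (t + a)" for t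
  have chart: "unit_speed_chart \<Gamma> J \<gamma>"
    unfolding J_def \<gamma>_def[abs_def] by (rule unit_speed_chart_translate[OF chart0])
  have J: "is_interval J" "interior J \<noteq> {}" using chart unfolding unit_speed_chart_def by blast+
  have "0 \<in> J" unfolding J_def using a by simp
  from interval_near_zero[OF J this]
  obtain \<rho> C where \<rho>: "0 < \<rho>" "J \<inter> {-\<rho><..<\<rho>} \<in> centred_intervals \<rho>"
    and C: "compact C" "J \<inter> {-\<rho><..<\<rho>} \<subseteq> C" "C \<subseteq> J" by blast
  have "det (deriv_matrix \<gamma> s) \<noteq> 0" if "s \<in> J" for s
    using assms(1) chart that unfolding nondegenerate_curve_def by blast
  from chart_bounds_on_compact[OF chart this C(1,3)]
  obtain M \<kappa> where \<kappa>: "0 < \<kappa>" "chart_bounds M \<kappa> C \<gamma>" by blast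
  then have "chart_bounds M \<kappa> (J \<inter> {-\<rho><..<\<rho>}) \<gamma>" using C(2) unfolding chart_bounds_def by blast
  moreover have "unit_speed_chart \<Gamma> (J \<inter> {-\<rho><..<\<rho>}) \<gamma>"
    using centred_interval_props(1,2)[OF \<rho>(2,1)]
    by (intro unit_speed_chart_restrict[OF chart]) (auto intro: openin_open_Int)
  moreover have "\<gamma> 0 = p" unfolding \<gamma>_def a by simp
  ultimately show ?thesis using \<rho> \<kappa>(1) by blast
qed

text \<open>
  A full interval of radius \<open>r\<close> around \<open>a\<close> either fits into \<open>J\<close> or it reaches beyond the
  boundary parameter \<open>0\<close>; in the second case the half-open interval of length \<open>r\<close> at \<open>0\<close> contains \<open>a\<close>. The
  other end of \<open>J\<close> is out of reach because \<open>\<bar>a\<bar> < \<rho> / 2\<close> and \<open>r \<le> \<rho> / 2\<close>.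
\<close>
lemma recentre_chart:
  fixes \<gamma> :: "real \<Rightarrow> real ^ 'n"
  assumes chart: "unit_speed_chart \<Gamma> J \<gamma>" and J: "J \<in> centred_intervals \<rho>"
    and bounds: "chart_bounds M \<kappa> J \<gamma>"
    and a: "a \<in> J" "\<bar>a\<bar> < \<rho> / 2" and r: "0 < r" "r \<le> \<rho> / 2"
  shows "\<exists>J' \<gamma>'. unit_speed_chart \<Gamma> J' \<gamma>' \<and> J' \<in> centred_intervals r \<and>
           chart_bounds M \<kappa> J' \<gamma>' \<and> \<gamma> a \<in> \<gamma>' ` J'"
proof -
  have "\<exists>b. a \<in> {b - r<..<b + r} \<and> {t. t + b \<in> J \<inter> {b - r<..<b + r}} \<in> centred_intervals r"
  proof (cases "{a - r<..<a + r} \<subseteq> J")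
    case True
    then have "{t. t + a \<in> J \<inter> {a - r<..<a + r}} = {-r<..<r}" by force
    then show ?thesis using r(1) by (intro exI[of _ a]) (auto simp: centred_intervals_def)
  next
    case False
    have "J \<noteq> {-\<rho><..<\<rho>}" using False a(2) r(2) by auto
    then have cases: "J = {0..<\<rho>} \<or> J = {-\<rho><..0}" using J unfolding centred_intervals_def by blast
    have near: "a \<in> {0 - r<..<0 + r}"
      using cases
    proof
      assume eq: "J = {0..<\<rho>}"
      have "a < r"
      proof (rule ccontr)
        assume "\<not> a < r"
        then have "{a - r<..<a + r} \<subseteq> {0..<\<rho>}" using a(2) r(2) by auto
        then show False using False eq by blast
      qed
      then show ?thesis using a(1) r(1) unfolding eq by simp
    next
      assume eq: "J = {-\<rho><..0}"
      have "- r < a"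
      proof (rule ccontr)
        assume "\<not> - r < a"
        then have "{a - r<..<a + r} \<subseteq> {-\<rho><..0}" using a(2) r(2) by auto
        then show False using False eq by blast
      qed
      then show ?thesis using a(1) r(1) unfolding eq by simp
    qed
    have "{t. t + 0 \<in> J \<inter> {0 - r<..<0 + r}} = {0..<r} \<or> {t. t + 0 \<in> J \<inter> {0 - r<..<0 + r}} = {-r<..0}"
      using cases
    proof
      assume eq: "J = {0..<\<rho>}"
      show ?thesis unfolding eq using r by (intro disjI1) auto
    next
      assume eq: "J = {-\<rho><..0}"
      show ?thesis unfolding eq using r by (intro disjI2) auto
    qed
    then have "{t. t + 0 \<in> J \<inter> {0 - r<..<0 + r}} \<in> centred_intervals r"
      unfolding centred_intervals_def by blast
    then show ?thesis using near by blast
  qed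
  then obtain b where b: "a \<in> {b - r<..<b + r}"
    and cen: "{t. t + b \<in> J \<inter> {b - r<..<b + r}} \<in> centred_intervals r" (is "?J' \<in> _") by blast
  let ?\<gamma>' = "\<lambda>t. \<gamma> (t + b)"
  have "openin (top_of_set {t. t + b \<in> J}) ({t. t + b \<in> J} \<inter> {-r<..<r})"
    by (intro openin_open_Int) auto
  moreover have eq: "{t. t + b \<in> J} \<inter> {-r<..<r} = ?J'" by auto
  ultimately have "unit_speed_chart \<Gamma> ?J' ?\<gamma>'"
    using centred_interval_props(1,2)[OF cen r(1)]
    by (intro unit_speed_chart_restrict[OF unit_speed_chart_translate[OF chart, of b]]) simp_all
  moreover have "chart_bounds M \<kappa> ?J' ?\<gamma>'"
    using bounds unfolding chart_bounds_def vderiv_translate by blast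
  moreover have "\<gamma> a \<in> ?\<gamma>' ` ?J'"
    using a(1) b by (intro image_eqI[of _ _ "a - b"]) auto
  ultimately show ?thesis using cen by blast
qed

lemma compact_pointwise_subcover:
  assumes "compact S" and "\<And>p. p \<in> S \<Longrightarrow> openin (top_of_set S) (U p)" and "\<And>p. p \<in> S \<Longrightarrow> p \<in> U p"
  obtains F where "finite F" and "F \<subseteq> S" and "S \<subseteq> (\<Union>p\<in>F. U p)"
proof -
  have "(\<forall>c\<in>U ` S. openin (top_of_set S) c) \<and> S \<subseteq> \<Union> (U ` S)" using assms(2,3) by blast
  then obtain D where "D \<subseteq> U ` S" "finite D" "S \<subseteq> \<Union>D"
    using assms(1) unfolding compact_eq_openin_cover by meson
  then show thesis using that by (metis finite_subset_image)
qed

text \<open>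
  A single extraction of a finite subcover would give charts of different radii. Covering by
  the halves of the charts first determines a radius \<open>r\<close> for which each point is covered by
  a chart of radius exactly \<open>r\<close>, cut out of one of finitely many charts and so with common bounds.
\<close>
lemma uniform_data_exists:
  fixes \<Gamma> :: "(real ^ 'n) set"
  assumes nd: "nondegenerate_curve \<Gamma>"
  shows "\<exists>K r M \<kappa>. uniform_data \<Gamma> K r M \<kappa>"
proof -
  have comp: "compact \<Gamma>" and ne: "\<Gamma> \<noteq> {}"
    using nd unfolding nondegenerate_curve_def compact_embedded_curve_def by blast+
  obtain J \<gamma> \<rho> M \<kappa> where loc: "\<And>p. p \<in> \<Gamma> \<Longrightarrow> 0 < \<rho> p \<and> 0 < \<kappa> p \<and> unit_speed_chart \<Gamma> (J p) (\<gamma> p) \<and>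
      J p \<in> centred_intervals (\<rho> p) \<and> chart_bounds (M p) (\<kappa> p) (J p) (\<gamma> p) \<and> \<gamma> p 0 = p"
    using local_chart[OF nd] by metis
  define U where "U p = \<gamma> p ` (J p \<inter> {- \<rho> p / 2<..<\<rho> p / 2})" for p
  have openU: "openin (top_of_set \<Gamma>) (U p)" if p: "p \<in> \<Gamma>" for p
  proof -
    obtain g where op: "openin (top_of_set \<Gamma>) (\<gamma> p ` J p)" and hom: "homeomorphism (J p) (\<gamma> p ` J p) (\<gamma> p) g"
      using loc[OF p] unfolding unit_speed_chart_def by blast
    have "openin (top_of_set (J p)) (J p \<inter> {- \<rho> p / 2<..<\<rho> p / 2})" by (intro openin_open_Int) auto
    then show ?thesis
      unfolding U_def using homeomorphism_imp_open_map[OF hom] op openin_trans by blast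
  qed
  have inU: "p \<in> U p" if "p \<in> \<Gamma>" for p
  proof -
    have "0 \<in> J p" using loc[OF that] centred_interval_props(3) by blast
    then show ?thesis unfolding U_def using loc[OF that] by (intro image_eqI[of _ _ 0]) auto
  qed
  obtain F where F: "finite F" "F \<subseteq> \<Gamma>" "\<Gamma> \<subseteq> (\<Union>p\<in>F. U p)"
    using compact_pointwise_subcover[OF comp openU inU] by blast
  have "F \<noteq> {}" using F(3) ne by auto
  define r where "r = Min (\<rho> ` F) / 2"
  define M0 where "M0 = Max (M ` F)"
  define \<kappa>0 where "\<kappa>0 = Min (\<kappa> ` F)"
  have "Min (\<rho> ` F) \<in> \<rho> ` F" "\<kappa>0 \<in> \<kappa> ` F"
    unfolding \<kappa>0_def using F(1) \<open>F \<noteq> {}\<close> by (intro Min_in; simp)+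
  then have pos: "0 < r" "0 < \<kappa>0" unfolding r_def using loc F(2) by auto
  have ext: "r \<le> \<rho> p / 2" "M p \<le> M0" "\<kappa>0 \<le> \<kappa> p" if "p \<in> F" for p
    unfolding r_def M0_def \<kappa>0_def using F(1) that by auto
  \<comment> \<open>Every point of the curve now has a chart of radius exactly \<open>r\<close> with the common bounds.\<close>
  have "\<exists>J' \<gamma>'. unit_speed_chart \<Gamma> J' \<gamma>' \<and> J' \<in> centred_intervals r \<and>
           chart_bounds M0 \<kappa>0 J' \<gamma>' \<and> q \<in> \<gamma>' ` J'" if q: "q \<in> \<Gamma>" for q
  proof -
    obtain p where p: "p \<in> F" "q \<in> U p" using F(3) q by blast
    then obtain a where a: "a \<in> J p" "\<bar>a\<bar> < \<rho> p / 2" "q = \<gamma> p a" unfolding U_def by auto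
    have l: "unit_speed_chart \<Gamma> (J p) (\<gamma> p)" "J p \<in> centred_intervals (\<rho> p)"
        "chart_bounds (M p) (\<kappa> p) (J p) (\<gamma> p)"
      using loc F(2) p(1) by blast+
    have "chart_bounds M0 \<kappa>0 (J p) (\<gamma> p)"
      using l(3) ext(2,3)[OF p(1)] unfolding chart_bounds_def by (meson order_trans)
    from recentre_chart[OF l(1,2) this a(1,2) pos(1) ext(1)[OF p(1)]]
    show ?thesis unfolding a(3) .
  qed
  then obtain J' \<gamma>' where chart: "\<And>q. q \<in> \<Gamma> \<Longrightarrow> unit_speed_chart \<Gamma> (J' q) (\<gamma>' q) \<and>
      J' q \<in> centred_intervals r \<and> chart_bounds M0 \<kappa>0 (J' q) (\<gamma>' q) \<and> q \<in> \<gamma>' q ` J' q"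
    by metis
  have op: "openin (top_of_set \<Gamma>) (\<gamma>' q ` J' q)" if "q \<in> \<Gamma>" for q
    using chart[OF that] unfolding unit_speed_chart_def by blast
  obtain G where G: "finite G" "G \<subseteq> \<Gamma>" "\<Gamma> \<subseteq> (\<Union>q\<in>G. \<gamma>' q ` J' q)"
  proof (rule compact_pointwise_subcover[OF comp op])
    show "q \<in> \<gamma>' q ` J' q" if "q \<in> \<Gamma>" for q using chart[OF that] by simp
  qed
  obtain e where e: "bij_betw e {..<card G} G"
    using ex_bij_betw_nat_finite[OF G(1)] by (auto simp: atLeast0LessThan)
  have eG: "e k \<in> G" if "k < card G" for k using bij_betwE[OF e] that by blast
  have "(\<Union>q\<in>G. \<gamma>' q ` J' q) \<subseteq> \<Gamma>" using op G(2) openin_imp_subset by blast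
  then have "\<Gamma> = (\<Union>q\<in>e ` {..<card G}. \<gamma>' q ` J' q)"
    using G(3) bij_betw_imp_surj_on[OF e] by auto
  then have "\<Gamma> = (\<Union>k<card G. \<gamma>' (e k) ` J' (e k))" by auto
  moreover have "unit_speed_chart \<Gamma> (J' (e k)) (\<gamma>' (e k)) \<and> J' (e k) \<in> centred_intervals r \<and>
      chart_bounds M0 \<kappa>0 (J' (e k)) (\<gamma>' (e k))" if "k < card G" for k
    using chart[of "e k"] eG[OF that] G(2) by auto
  ultimately have "\<exists>J \<gamma>. \<Gamma> = (\<Union>k<card G. \<gamma> k ` J k) \<and> (\<forall>k<card G.
      unit_speed_chart \<Gamma> (J k) (\<gamma> k) \<and> J k \<in> centred_intervals r \<and> chart_bounds M0 \<kappa>0 (J k) (\<gamma> k))"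
    by (intro exI[where x = "\<lambda>k. J' (e k)"] exI[where x = "\<lambda>k. \<gamma>' (e k)"] conjI allI impI) blast+
  then have "uniform_data \<Gamma> (card G) r M0 \<kappa>0"
    unfolding uniform_data_iff using pos by simp
  then show ?thesis by blast
qed

section \<open>The box number of a non-degenerate curve\<close>

theorem proposition4p5:
  assumes "2 \<le> CARD('n::finite)"
  shows "(\<forall>\<Gamma> :: (real ^ 'n) set. nondegenerate_curve \<Gamma> \<longrightarrow>
            (\<exists>K r M \<kappa>. uniform_data \<Gamma> K r M \<kappa>)) \<and>
         (\<forall>K r M \<kappa>. \<exists>c C :: real. 0 < c \<and> c \<le> C \<and>
            (\<forall>\<Gamma> :: (real ^ 'n) set. nondegenerate_curve \<Gamma> \<and> uniform_data \<Gamma> K r M \<kappa> \<longrightarrow>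
              (\<forall>\<delta>\<in>Delta CARD('n).
                 c * inverse (MIN i\<in>{1..CARD('n)}. \<delta> i powr (1 / real i)) \<le> real (box_number \<Gamma> \<delta>) \<and>
                 real (box_number \<Gamma> \<delta>) \<le> C * inverse (MIN i\<in>{1..CARD('n)}. \<delta> i powr (1 / real i)))))"
proof (intro conjI allI impI)
  fix \<Gamma> :: "(real ^ 'n) set"
  assume "nondegenerate_curve \<Gamma>"
  then show "\<exists>K r M \<kappa>. uniform_data \<Gamma> K r M \<kappa>" by (rule uniform_data_exists)
next
  fix K :: nat and r M \<kappa> :: real
  define L where "L = (1 + (M + 1) / \<kappa>) ^ CARD('n)"
  define h where "h = min (r / 2) (1 / (4 * L * M))"
  define c where "c = h / (2 ^ (CARD('n) + 1) * (4 * L * real CARD('n)))"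
  define C where "C = real K * (2 * r * (2 * M + 1) + 1)"
  show "\<exists>c C :: real. 0 < c \<and> c \<le> C \<and>
            (\<forall>\<Gamma> :: (real ^ 'n) set. nondegenerate_curve \<Gamma> \<and> uniform_data \<Gamma> K r M \<kappa> \<longrightarrow>
              (\<forall>\<delta>\<in>Delta CARD('n).
                 c * inverse (MIN i\<in>{1..CARD('n)}. \<delta> i powr (1 / real i)) \<le> real (box_number \<Gamma> \<delta>) \<and>
                 real (box_number \<Gamma> \<delta>) \<le> C * inverse (MIN i\<in>{1..CARD('n)}. \<delta> i powr (1 / real i))))"
  proof (cases "0 < r \<and> 0 < \<kappa> \<and> 1 \<le> M")
    case True
    have "0 < L" unfolding L_def using True by (simp add: add_pos_pos)
    then have "0 < h" unfolding h_def using True by simp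
    then have "0 < c" unfolding c_def using \<open>0 < L\<close> by simp
    show ?thesis
    proof (rule exI[of _ c], rule exI[of _ "max c C"], intro conjI allI impI ballI)
      fix \<Gamma> :: "(real ^ 'n) set" and \<delta>
      assume \<Gamma>: "nondegenerate_curve \<Gamma> \<and> uniform_data \<Gamma> K r M \<kappa>" and \<delta>: "\<delta> \<in> Delta CARD('n)"
      define \<eta> where "\<eta> = (MIN i\<in>{1..CARD('n)}. \<delta> i powr (1 / real i))"
      have "\<Gamma> \<noteq> {}" using \<Gamma> unfolding nondegenerate_curve_def compact_embedded_curve_def by blast
      note bounds = box_number_bounds(1,2)[OF conjunct2[OF \<Gamma>] this \<delta> L_def h_def \<eta>_def]
      show "c * inverse (MIN i\<in>{1..CARD('n)}. \<delta> i powr (1 / real i)) \<le> real (box_number \<Gamma> \<delta>)"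
        using bounds(1) unfolding c_def \<eta>_def .
      have "0 < \<eta>" using Min_root_Delta(1)[OF \<delta> _ \<eta>_def] by (simp add: Suc_leI)
      then have "C * inverse \<eta> \<le> max c C * inverse \<eta>" by (intro mult_right_mono) auto
      then show "real (box_number \<Gamma> \<delta>) \<le> max c C * inverse (MIN i\<in>{1..CARD('n)}. \<delta> i powr (1 / real i))"
        using bounds(2) unfolding C_def[symmetric] \<eta>_def[symmetric] by linarith
    qed (use \<open>0 < c\<close> in auto)
  next
    case False
    \<comment> \<open>No curve has these data, so any constants do.\<close>
    have "\<not> (nondegenerate_curve \<Gamma> \<and> uniform_data \<Gamma> K r M \<kappa>)" for \<Gamma> :: "(real ^ 'n) set"
    proof
      assume \<Gamma>: "nondegenerate_curve \<Gamma> \<and> uniform_data \<Gamma> K r M \<kappa>"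
      then have "\<Gamma> \<noteq> {}" unfolding nondegenerate_curve_def compact_embedded_curve_def by blast
      moreover have "(\<lambda>_. 1 / 2) \<in> Delta CARD('n)" by (simp add: Delta_def)
      ultimately show False
        using False box_number_bounds(3-5)[OF conjunct2[OF \<Gamma>] _ _ L_def h_def refl] by blast
    qed
    then show ?thesis by (intro exI[of _ 1]) auto
  qed
qed

end
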